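(* Let $\Sigma$ be an orientable $(n-1)$-dimensional compact embedded submanifold of an orientable totally geodesic hypersurface $P^n\subset\overline{M}^{n+1}$, and let $\psi:M^n\to\overline{M}^{n+1}$ be an orientable hypersurface with boundary $\Sigma=\psi(\partial M)$. Then each one of the following hypotheses individually implies that $M$ is transverse to $P$ along the boundary $\partial M$: (a) for some given $1\le r\le n-1$, the Newton transformation $T_r$ is positive definite on $M$; (b) $n\ge 3$ and $S_n\neq 0$ everywhere on $M$; (c) $S_2>0$ everywhere on $M$.
   Context: $\overline{M}^{n+1}$ is a connected oriented Riemannian manifold with Levi-Civita connection $\overline\nabla$. A hypersurface is an isometric immersion $\psi:M^n\to\overline{M}^{n+1}$ of a connected orientable $n$-manifold with smooth boundary $\partial M$, oriented by a global unit normal ${\bf N}$; its shape operator is $A(V)=-\overline\nabla_V{\bf N}$. $M$ has boundary $\Sigma$ if $\psi|_{\partial M}$ is a diffeomorphism onto $\Sigma$. $S_r$ is the $r$-th elementary symmetric function of the eigenvalues of $A$ ($S_0=1$), and $T_0=I$, $T_r=S_rI-AT_{r-1}$ are the Newton transformations. $M$ is transverse to $P$ along $\partial M$ if $M$ is never tangent to $P$ at a point of $\partial M$; equivalently $\langle\xi,\nu\rangle\ne0$ everywhere on $\partial M$, where $\xi$ is a unit normal to $P$ in $\overline{M}$ and $\nu$ is the outward unit conormal of $M$ along $\partial M$. *)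

theory Defs
  imports "HOL-Analysis.Analysis"
begin

primrec Ck_on :: "nat \<Rightarrow> ('x::euclidean_space \<Rightarrow> 'y::real_normed_vector) \<Rightarrow> 'x set \<Rightarrow> bool" where
  "Ck_on 0 f U \<longleftrightarrow> continuous_on U f"
| "Ck_on (Suc k) f U \<longleftrightarrow>
     (\<forall>x\<in>U. f differentiable (at x)) \<and> (\<forall>v. Ck_on k (\<lambda>x. frechet_derivative f (at x) v) U)"

text \<open>On a set that is not open, smooth means: locally the restriction of a smooth map
  on an open set.\<close>

definition smooth_on :: "('x::euclidean_space \<Rightarrow> 'y::real_normed_vector) \<Rightarrow> 'x set \<Rightarrow> bool" where
  "smooth_on f S \<longleftrightarrow>
     (\<forall>x\<in>S. \<exists>U h. open U \<and> x \<in> U \<and> (\<forall>k. Ck_on k h U) \<and> (\<forall>y\<in>S \<inter> U. h y = f y))"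

text \<open>A chart is a pair of a domain and a coordinate map; the coordinate map is only
  meaningful on the domain. The atlas need not be maximal.\<close>

type_synonym ('a, 'e) chart = "'a set \<times> ('a \<Rightarrow> 'e)"

record ('a, 'e) mfd =
  mtop :: "'a topology"
  atlas :: "('a, 'e) chart set"

abbreviation pts :: "('a, 'e) mfd \<Rightarrow> 'a set" where
  "pts M \<equiv> topspace (mtop M)"

definition chart_image :: "('a, 'e) chart \<Rightarrow> 'e set" where
  "chart_image c = snd c ` fst c"

definition chart_inv :: "('a, 'e) chart \<Rightarrow> 'e \<Rightarrow> 'a" where
  "chart_inv c = inv_into (fst c) (snd c)"

text \<open>The image of a chart is relatively open in the set of all \<open>x\<close> with \<open>0 \<le> h \<bullet> x\<close>, which
  is a closed half-space for nonzero \<open>h\<close> and the whole space for \<open>h = 0\<close>.\<close>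

definition is_chart :: "'a topology \<Rightarrow> ('a, 'e::euclidean_space) chart \<Rightarrow> bool" where
  "is_chart X c \<longleftrightarrow>
     openin X (fst c) \<and>
     homeomorphic_map (subtopology X (fst c)) (top_of_set (chart_image c)) (snd c) \<and>
     (\<exists>h. openin (top_of_set {x. 0 \<le> h \<bullet> x}) (chart_image c))"

definition smooth_compatible ::
  "('a, 'e::euclidean_space) chart \<Rightarrow> ('a, 'e) chart \<Rightarrow> bool" where
  "smooth_compatible c d \<longleftrightarrow>
     smooth_on (snd d \<circ> chart_inv c) (snd c ` (fst c \<inter> fst d)) \<and>
     smooth_on (snd c \<circ> chart_inv d) (snd d ` (fst c \<inter> fst d))"

definition smooth_manifold :: "('a, 'e::euclidean_space) mfd \<Rightarrow> bool" where
  "smooth_manifold M \<longleftrightarrow>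
     Hausdorff_space (mtop M) \<and> second_countable (mtop M) \<and>
     (\<forall>c\<in>atlas M. is_chart (mtop M) c) \<and>
     (\<Union>c\<in>atlas M. fst c) = pts M \<and>
     (\<forall>c\<in>atlas M. \<forall>d\<in>atlas M. smooth_compatible c d)"

definition mboundary :: "('a, 'e::euclidean_space) mfd \<Rightarrow> 'a set" where
  "mboundary M = {p \<in> pts M. \<exists>c\<in>atlas M. p \<in> fst c \<and> snd c p \<notin> interior (chart_image c)}"

text \<open>A preferred chart is chosen at every point; the tangent space at \<open>p\<close> is identified with
  the model space by means of the coordinates of that chart. Hence a vector field, or a vector
  field along a map, is a function from points to the model space.\<close>

definition chart_at :: "('a, 'e) mfd \<Rightarrow> 'a \<Rightarrow> ('a, 'e) chart" where
  "chart_at M p = (SOME c. c \<in> atlas M \<and> p \<in> fst c)"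

text \<open>Change of the components of a tangent vector at \<open>p\<close> from the chart \<open>c\<close> to the chart \<open>d\<close>.
  Derivatives are taken within chart images, which also makes sense at boundary points.\<close>

definition transition ::
  "('a, 'e::euclidean_space) chart \<Rightarrow> ('a, 'e) chart \<Rightarrow> 'a \<Rightarrow> 'e \<Rightarrow> 'e" where
  "transition c d p =
     frechet_derivative (snd d \<circ> chart_inv c) (at (snd c p) within chart_image c)"

definition mderiv ::
  "('a, 'e::euclidean_space) mfd \<Rightarrow> ('b, 'f::euclidean_space) mfd \<Rightarrow> ('a \<Rightarrow> 'b) \<Rightarrow> 'a \<Rightarrow> 'e \<Rightarrow> 'f" where
  "mderiv M N f p =
     (let c = chart_at M p; d = chart_at N (f p) in
      frechet_derivative (snd d \<circ> f \<circ> chart_inv c) (at (snd c p) within chart_image c))"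

text \<open>Smoothness of the restriction of \<open>f\<close> to a subset \<open>A\<close> of \<open>M\<close>; if \<open>A\<close> is an embedded
  submanifold of \<open>M\<close> (such as the boundary), this is smoothness for the induced structure.\<close>

definition smooth_map_on ::
  "('a, 'e::euclidean_space) mfd \<Rightarrow> 'a set \<Rightarrow> ('b, 'f::euclidean_space) mfd \<Rightarrow> ('a \<Rightarrow> 'b) \<Rightarrow> bool" where
  "smooth_map_on M A N f \<longleftrightarrow>
     continuous_map (subtopology (mtop M) A) (mtop N) f \<and>
     (\<forall>c\<in>atlas M. \<forall>d\<in>atlas N.
        smooth_on (snd d \<circ> f \<circ> chart_inv c) (snd c ` (fst c \<inter> A \<inter> f -` fst d)))"

abbreviation smooth_map ::
  "('a, 'e::euclidean_space) mfd \<Rightarrow> ('b, 'f::euclidean_space) mfd \<Rightarrow> ('a \<Rightarrow> 'b) \<Rightarrow> bool" where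
  "smooth_map M N f \<equiv> smooth_map_on M (pts M) N f"

definition immersion ::
  "('a, 'e::euclidean_space) mfd \<Rightarrow> ('b, 'f::euclidean_space) mfd \<Rightarrow> ('a \<Rightarrow> 'b) \<Rightarrow> bool" where
  "immersion M N f \<longleftrightarrow> smooth_map M N f \<and> (\<forall>p\<in>pts M. inj (mderiv M N f p))"

text \<open>An embedded submanifold without boundary: a subset carrying the subspace topology and a
  smooth structure for which the inclusion is an immersion.\<close>

definition embedded_submanifold ::
  "('a, 'e::euclidean_space) mfd \<Rightarrow> ('a, 'f::euclidean_space) mfd \<Rightarrow> bool" where
  "embedded_submanifold S P \<longleftrightarrow>
     smooth_manifold S \<and> mboundary S = {} \<and>
     pts S \<subseteq> pts P \<and> mtop S = subtopology (mtop P) (pts S) \<and>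
     immersion S P id"

definition orientation :: "('a, real^'n) mfd \<Rightarrow> ('a, real^'n) chart set \<Rightarrow> bool" where
  "orientation M Or \<longleftrightarrow>
     (\<forall>c\<in>Or. is_chart (mtop M) c \<and> (\<forall>d\<in>atlas M. smooth_compatible c d)) \<and>
     (\<Union>c\<in>Or. fst c) = pts M \<and>
     (\<forall>c\<in>Or. \<forall>d\<in>Or. \<forall>p\<in>fst c \<inter> fst d. det (matrix (transition c d p)) > 0)"

definition orientable :: "('a, real^'n) mfd \<Rightarrow> bool" where
  "orientable M \<longleftrightarrow> (\<exists>Or. orientation M Or)"

text \<open>\<open>M\<close> has boundary \<open>S\<close>: the restriction of \<open>\<psi>\<close> to the boundary of \<open>M\<close> is a diffeomorphism
  onto the submanifold \<open>S\<close>. A map into the embedded submanifold \<open>mboundary M\<close> is smooth iff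
  it is smooth as a map into \<open>M\<close>.\<close>

definition has_boundary ::
  "('m, 'e::euclidean_space) mfd \<Rightarrow> ('m \<Rightarrow> 'a) \<Rightarrow> ('a, 'f::euclidean_space) mfd \<Rightarrow> bool" where
  "has_boundary M \<psi> S \<longleftrightarrow>
     bij_betw \<psi> (mboundary M) (pts S) \<and>
     smooth_map_on M (mboundary M) S \<psi> \<and>
     smooth_map S M (inv_into (mboundary M) \<psi>)"

type_synonym ('a, 'e) metric = "'a \<Rightarrow> 'e \<Rightarrow> 'e \<Rightarrow> real"

definition metric_in_chart ::
  "('a, 'e::euclidean_space) mfd \<Rightarrow> ('a, 'e) metric \<Rightarrow> ('a, 'e) chart \<Rightarrow> 'e \<Rightarrow> 'e \<Rightarrow> 'e \<Rightarrow> real" where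
  "metric_in_chart M g c x u v =
     (let p = chart_inv c x
      in g p (transition c (chart_at M p) p u) (transition c (chart_at M p) p v))"

definition riemannian_metric :: "('a, 'e::euclidean_space) mfd \<Rightarrow> ('a, 'e) metric \<Rightarrow> bool" where
  "riemannian_metric M g \<longleftrightarrow>
     (\<forall>p\<in>pts M. bilinear (g p) \<and> (\<forall>u v. g p u v = g p v u) \<and> (\<forall>v. v \<noteq> 0 \<longrightarrow> g p v v > 0)) \<and>
     (\<forall>c\<in>atlas M. \<forall>u v. smooth_on (\<lambda>x. metric_in_chart M g c x u v) (chart_image c))"

text \<open>The Levi-Civita connection at \<open>p\<close>, in the preferred chart at \<open>p\<close>: \<open>\<Gamma> u v\<close> is the covariant
  derivative in direction \<open>u\<close> of the vector field with constant components \<open>v\<close>. It is the unique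
  torsion-free (i.e. symmetric, as coordinate fields commute) and metric such \<open>\<Gamma>\<close>.\<close>

definition levi_civita ::
  "('a, 'e::euclidean_space) mfd \<Rightarrow> ('a, 'e) metric \<Rightarrow> 'a \<Rightarrow> 'e \<Rightarrow> 'e \<Rightarrow> 'e" where
  "levi_civita M g p =
     (let c = chart_at M p in
      THE \<Gamma>. bilinear \<Gamma> \<and> (\<forall>u v. \<Gamma> u v = \<Gamma> v u) \<and>
        (\<forall>u v w. frechet_derivative (\<lambda>x. metric_in_chart M g c x v w)
                   (at (snd c p) within chart_image c) u
                 = g p (\<Gamma> u v) w + g p v (\<Gamma> u w)))"

text \<open>The covariant derivative at \<open>p\<close>, in direction \<open>v\<close>, of a vector field \<open>X\<close> along \<open>f\<close>: the
  derivative of the components of \<open>X\<close> in the preferred chart at \<open>f p\<close>, plus the Christoffel term.\<close>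

definition cov_deriv_along ::
  "('a, 'e::euclidean_space) mfd \<Rightarrow> ('b, 'f::euclidean_space) mfd \<Rightarrow> ('b, 'f) metric \<Rightarrow>
   ('a \<Rightarrow> 'b) \<Rightarrow> ('a \<Rightarrow> 'f) \<Rightarrow> 'a \<Rightarrow> 'e \<Rightarrow> 'f" where
  "cov_deriv_along M N g f X p v =
     (let c = chart_at M p; d = chart_at N (f p) in
      frechet_derivative
        (\<lambda>x. let q = chart_inv c x in transition (chart_at N (f q)) d (f q) (X q))
        (at (snd c p) within chart_image c) v
      + levi_civita N g (f p) (mderiv M N f p v) (X p))"

definition smooth_along ::
  "('a, 'e::euclidean_space) mfd \<Rightarrow> ('b, 'f::euclidean_space) mfd \<Rightarrow> ('a \<Rightarrow> 'b) \<Rightarrow> ('a \<Rightarrow> 'f) \<Rightarrow> bool" where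
  "smooth_along M N f X \<longleftrightarrow>
     (\<forall>c\<in>atlas M. \<forall>d\<in>atlas N.
        smooth_on (\<lambda>x. let q = chart_inv c x in transition (chart_at N (f q)) d (f q) (X q))
          (snd c ` (fst c \<inter> f -` fst d)))"

definition unit_normal ::
  "('a, 'e::euclidean_space) mfd \<Rightarrow> ('b, 'f::euclidean_space) mfd \<Rightarrow> ('b, 'f) metric \<Rightarrow>
   ('a \<Rightarrow> 'b) \<Rightarrow> ('a \<Rightarrow> 'f) \<Rightarrow> bool" where
  "unit_normal M N g f X \<longleftrightarrow>
     smooth_along M N f X \<and>
     (\<forall>p\<in>pts M. g (f p) (X p) (X p) = 1 \<and> (\<forall>v. g (f p) (X p) (mderiv M N f p v) = 0))"

definition isometric_immersion ::
  "('a, 'e::euclidean_space) mfd \<Rightarrow> ('a, 'e) metric \<Rightarrow> ('b, 'f::euclidean_space) mfd \<Rightarrow>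
   ('b, 'f) metric \<Rightarrow> ('a \<Rightarrow> 'b) \<Rightarrow> bool" where
  "isometric_immersion M g N h f \<longleftrightarrow>
     immersion M N f \<and>
     (\<forall>p\<in>pts M. \<forall>u v. g p u v = h (f p) (mderiv M N f p u) (mderiv M N f p v))"

definition hypersurface ::
  "('m, real^'n) mfd \<Rightarrow> ('m, real^'n) metric \<Rightarrow> ('a, real^'k) mfd \<Rightarrow> ('a, real^'k) metric \<Rightarrow>
   ('m \<Rightarrow> 'a) \<Rightarrow> ('m \<Rightarrow> real^'k) \<Rightarrow> bool" where
  "hypersurface M g Mbar gbar \<psi> N \<longleftrightarrow>
     CARD('k) = CARD('n) + 1 \<and>
     smooth_manifold M \<and> connected_space (mtop M) \<and> orientable M \<and>
     riemannian_metric M g \<and> isometric_immersion M g Mbar gbar \<psi> \<and>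
     unit_normal M Mbar gbar \<psi> N"

definition shape_operator ::
  "('m, 'e::euclidean_space) mfd \<Rightarrow> ('a, 'f::euclidean_space) mfd \<Rightarrow> ('a, 'f) metric \<Rightarrow>
   ('m \<Rightarrow> 'a) \<Rightarrow> ('m \<Rightarrow> 'f) \<Rightarrow> 'm \<Rightarrow> 'e \<Rightarrow> 'e" where
  "shape_operator M Mbar gbar \<psi> N p v =
     (THE w. mderiv M Mbar \<psi> p w = - cov_deriv_along M Mbar gbar \<psi> N p v)"

definition totally_geodesic ::
  "('m, 'e::euclidean_space) mfd \<Rightarrow> ('a, 'f::euclidean_space) mfd \<Rightarrow> ('a, 'f) metric \<Rightarrow>
   ('m \<Rightarrow> 'a) \<Rightarrow> ('m \<Rightarrow> 'f) \<Rightarrow> bool" where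
  "totally_geodesic M Mbar gbar \<psi> N \<longleftrightarrow>
     (\<forall>p\<in>pts M. \<forall>v. shape_operator M Mbar gbar \<psi> N p v = 0)"

text \<open>Index set of the eigenvalues with multiplicity: the eigenvalue \<open>k\<close> occurs once for each
  \<open>i\<close> below the dimension of its eigenspace. Shape operators are self-adjoint for the induced
  metric, hence diagonalizable, so geometric and algebraic multiplicities coincide.\<close>

definition eigen_index :: "('e::euclidean_space \<Rightarrow> 'e) \<Rightarrow> (real \<times> nat) set" where
  "eigen_index A = (SIGMA k:UNIV. {..<dim {v. A v = k *\<^sub>R v}})"

definition sym_fun :: "nat \<Rightarrow> ('e::euclidean_space \<Rightarrow> 'e) \<Rightarrow> real" where
  "sym_fun r A = (\<Sum>J | J \<subseteq> eigen_index A \<and> card J = r. \<Prod>(k, i)\<in>J. k)"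

primrec newton :: "nat \<Rightarrow> ('e::euclidean_space \<Rightarrow> 'e) \<Rightarrow> 'e \<Rightarrow> 'e" where
  "newton 0 A v = v"
| "newton (Suc r) A v = sym_fun (Suc r) A *\<^sub>R v - A (newton r A v)"

text \<open>Both ranges are hyperplanes of the same tangent space of \<open>Mbar\<close>, so \<open>M\<close> is tangent to \<open>P\<close>
  exactly when they are equal. The carrier of \<open>P\<close> is a subset of that of \<open>Mbar\<close>, but \<open>P\<close> has its
  own topology and atlas; its tangent spaces are embedded by the differential of the inclusion.\<close>

definition transverse_along_boundary ::
  "('m, 'e::euclidean_space) mfd \<Rightarrow> ('a, 'f::euclidean_space) mfd \<Rightarrow> ('m \<Rightarrow> 'a) \<Rightarrow>
   ('a, 'e) mfd \<Rightarrow> bool" where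
  "transverse_along_boundary M Mbar \<psi> P \<longleftrightarrow>
     (\<forall>p\<in>mboundary M. range (mderiv M Mbar \<psi> p) \<noteq> range (mderiv P Mbar id (\<psi> p)))"

end

theory Submission
  imports Defs
begin

text \<open>Suppose \<open>M\<close> is tangent to \<open>P\<close> at \<open>p \<in> \<partial>M\<close>. Differentiating \<open>\<langle>N, X\<rangle> = 0\<close> for \<open>X\<close> tangent to
  \<open>\<Sigma>\<close> shows that \<open>\<langle>A u, v\<rangle>\<close>, for \<open>u\<close> and \<open>v\<close> tangent to \<open>\<Sigma>\<close>, depends only on the inclusion of
  \<open>\<Sigma>\<close> in the ambient manifold and on the value of \<open>N\<close> at \<open>p\<close>. Since \<open>P\<close> contains \<open>\<Sigma>\<close>, is totally
  geodesic and has the same normal line at \<open>p\<close>, \<open>A\<close> vanishes as a bilinear form on the hyperplane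
  tangent to \<open>\<Sigma>\<close>. With \<open>\<nu>\<close> a unit conormal and \<open>A \<nu> = b + c \<nu>\<close>, \<open>b\<close> tangent to \<open>\<Sigma>\<close>, this gives
  \<open>S\<^sub>1 = c\<close>, \<open>S\<^sub>2 = - \<bar>b\<bar>\<^sup>2\<close>, \<open>S\<^sub>r = 0\<close> for \<open>r \<ge> 3\<close>, and \<open>\<langle>T\<^sub>r \<nu>, \<nu>\<rangle> = 0\<close> for \<open>r \<ge> 1\<close>, which
  contradicts each of the three hypotheses.\<close>

subsection \<open>Calculus of smooth maps on relatively open subsets of half-spaces\<close>

text \<open>To differentiate along \<Sigma>, a tangent vector must be extended to a field. In
  coordinates a constant field on a chart of \<Sigma>, pushed forward by the inclusion, does this,
  and its covariant derivative is the coordinate Hessian \<open>D2\<close> of the inclusion plus a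
  Christoffel term. The inclusion factors through \<open>M\<close>, by inverting
  \<open>\<psi>\<close> on the boundary, and through \<open>P\<close>, so the same \<open>D2\<close>
  serves both hypersurfaces. The obstacle is that \<open>M\<close> is studied exactly at boundary
  points, where a chart image is only relatively open in a half-space. Derivatives are taken within
  chart images, so their uniqueness, the chain rule and the symmetry of second derivatives must
  first be secured there. Since \<open>sym_fun\<close> counts eigenvalues by the dimensions of
  eigenspaces, the curvatures are computed from explicit eigenspaces instead of a characteristic
  polynomial. The term \<open>- \<bar>b\<bar>\<^sup>2\<close> need not vanish, which is why (b) asks
  for n at least 3.\<close>

lemma Ck_on_continuous_on: "Ck_on k f U \<Longrightarrow> continuous_on U f"
proof (cases k)
  case (Suc j)
  assume "Ck_on k f U"
  then have "\<forall>x\<in>U. isCont f x" using Suc by (simp add: differentiable_imp_continuous_within)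
  then show ?thesis by (simp add: continuous_at_imp_continuous_on)
qed simp

lemma Ck_on_subset: "Ck_on k f U \<Longrightarrow> V \<subseteq> U \<Longrightarrow> Ck_on k f V"
  by (induction k arbitrary: f) (auto intro: continuous_on_subset)

lemma Ck_on_SucD: "Ck_on (Suc k) f U \<Longrightarrow> Ck_on k f U"
proof (induction k arbitrary: f)
  case 0
  show ?case using Ck_on_continuous_on[OF 0] by simp
next
  case (Suc k)
  show ?case using Suc.prems Suc.IH by (subst Ck_on.simps, subst (asm) Ck_on.simps) blast
qed

lemma Ck_on_cong:
  assumes "open U" "\<And>x. x \<in> U \<Longrightarrow> f x = g x" "Ck_on k f U"
  shows "Ck_on k g U"
  using assms(2,3)
proof (induction k arbitrary: f g)
  case 0
  then show ?case by (simp cong: continuous_on_cong)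
next
  case (Suc k)
  have "g differentiable (at x)" if "x \<in> U" for x
    using Suc.prems that assms(1) has_derivative_transform_within_open
    unfolding Ck_on.simps differentiable_def by metis
  moreover have "Ck_on k (\<lambda>x. frechet_derivative g (at x) v) U" for v
  proof (rule Suc.IH)
    show "frechet_derivative f (at x) v = frechet_derivative g (at x) v" if "x \<in> U" for x
      using frechet_derivative_transform_within_open[OF _ assms(1) that Suc.prems(1)] Suc.prems that
      by simp
    show "Ck_on k (\<lambda>x. frechet_derivative f (at x) v) U" using Suc.prems by simp
  qed
  ultimately show ?case by simp
qed

lemma Ck_on_SucI:
  assumes "open U" "\<And>x. x \<in> U \<Longrightarrow> (f has_derivative f' x) (at x)"
    "\<And>v. Ck_on k (\<lambda>x. f' x v) U"
  shows "Ck_on (Suc k) f U"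
proof -
  have "frechet_derivative f (at x) = f' x" if "x \<in> U" for x
    using frechet_derivative_at[OF assms(2)[OF that]] by simp
  then have "Ck_on k (\<lambda>x. frechet_derivative f (at x) v) U" for v
    using Ck_on_cong[OF assms(1) _ assms(3)[of v]] by simp
  then show ?thesis using assms(2) by (auto simp: differentiable_def)
qed

lemma Ck_on_Suc_has_derivative:
  "Ck_on (Suc k) f U \<Longrightarrow> x \<in> U \<Longrightarrow> (f has_derivative frechet_derivative f (at x)) (at x)"
  by (simp add: frechet_derivative_works[symmetric])

lemma Ck_on_const: "open U \<Longrightarrow> Ck_on k (\<lambda>x. c) U"
  by (induction k arbitrary: c) auto

lemma Ck_on_add:
  assumes "open U" "Ck_on k f U" "Ck_on k g U"
  shows "Ck_on k (\<lambda>x. f x + g x) U"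
  using assms(2,3)
proof (induction k arbitrary: f g)
  case 0
  then show ?case by (auto intro: continuous_intros)
next
  case (Suc k)
  show ?case
    by (rule Ck_on_SucI[OF assms(1) has_derivative_add[OF
            Ck_on_Suc_has_derivative[OF Suc.prems(1)] Ck_on_Suc_has_derivative[OF Suc.prems(2)]]])
      (use Suc in auto)
qed

lemma Ck_on_sum:
  assumes "open U" "\<And>i. i \<in> I \<Longrightarrow> Ck_on k (f i) U"
  shows "Ck_on k (\<lambda>x. \<Sum>i\<in>I. f i x) U"
  using assms(2)
proof (induction I rule: infinite_finite_induct)
  case (insert i I)
  then show ?case by (simp add: Ck_on_add[OF assms(1)])
qed (simp_all add: Ck_on_const[OF assms(1)])

lemma Ck_on_bounded_linear:
  assumes "open U" "bounded_linear L" "Ck_on k f U"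
  shows "Ck_on k (\<lambda>x. L (f x)) U"
  using assms(3)
proof (induction k arbitrary: f)
  case 0
  then show ?case using bounded_linear.continuous_on[OF assms(2)] by auto
next
  case (Suc k)
  show ?case
    by (rule Ck_on_SucI[OF assms(1) bounded_linear.has_derivative[OF assms(2)
            Ck_on_Suc_has_derivative[OF Suc.prems]]])
      (use Suc in auto)
qed

lemma Ck_on_scaleR:
  assumes "open U" "Ck_on k f U" "Ck_on k g U"
  shows "Ck_on k (\<lambda>x. f x *\<^sub>R g x) U"
  using assms(2,3)
proof (induction k arbitrary: f g)
  case 0
  then show ?case by (auto intro: continuous_intros)
next
  case (Suc k)
  have "Ck_on k (\<lambda>x. f x *\<^sub>R frechet_derivative g (at x) v + frechet_derivative f (at x) v *\<^sub>R g x) U"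
    for v
    using Suc.prems
    by (intro Ck_on_add[OF assms(1)] Suc.IH Ck_on_SucD[OF Suc.prems(1)] Ck_on_SucD[OF Suc.prems(2)])
      simp_all
  note * = this
  show ?case
    by (rule Ck_on_SucI[OF assms(1) has_derivative_scaleR[OF
            Ck_on_Suc_has_derivative[OF Suc.prems(1)] Ck_on_Suc_has_derivative[OF Suc.prems(2)]]])
      (use * in auto)
qed

lemma linear_apply_basis:
  fixes L :: "'x::euclidean_space \<Rightarrow> 'y::real_vector"
  assumes "linear L"
  shows "L v = (\<Sum>b\<in>Basis. (v \<bullet> b) *\<^sub>R L b)"
proof -
  have "L v = L (\<Sum>b\<in>Basis. (v \<bullet> b) *\<^sub>R b)" by (simp add: euclidean_representation)
  also have "\<dots> = (\<Sum>b\<in>Basis. (v \<bullet> b) *\<^sub>R L b)"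
    using assms by (simp add: linear_sum linear_scale)
  finally show ?thesis .
qed

text \<open>Expanding the inner derivative in the standard basis turns the chain rule into a finite
  sum of products. In each product the derivative of \<open>g\<close> is taken in a fixed direction
  \<open>b\<close>, so the induction hypothesis covers its composition with
  \<open>f\<close>.\<close>

lemma Ck_on_compose:
  fixes f :: "'x::euclidean_space \<Rightarrow> 'y::euclidean_space"
    and g :: "'y \<Rightarrow> 'z::real_normed_vector"
  assumes "open U" "f ` U \<subseteq> V" "Ck_on k f U" "Ck_on k g V"
  shows "Ck_on k (\<lambda>x. g (f x)) U"
  using assms(3,4)
proof (induction k arbitrary: g)
  case 0
  then show ?case using assms(2) by (auto intro: continuous_on_compose2)
next
  case (Suc k)
  let ?f' = "\<lambda>x. frechet_derivative f (at x)" and ?g' = "\<lambda>y. frechet_derivative g (at y)"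
  have f': "(f has_derivative ?f' x) (at x)" if "x \<in> U" for x
    using Ck_on_Suc_has_derivative[OF Suc.prems(1) that] .
  have g': "(g has_derivative ?g' (f x)) (at (f x))" if "x \<in> U" for x
    using Ck_on_Suc_has_derivative[OF Suc.prems(2)] assms(2) that by blast
  have "Ck_on k (\<lambda>x. \<Sum>b\<in>Basis. (?f' x v \<bullet> b) *\<^sub>R ?g' (f x) b) U" for v
  proof (intro Ck_on_sum[OF assms(1)] Ck_on_scaleR[OF assms(1)])
    fix b :: 'y
    show "Ck_on k (\<lambda>x. ?f' x v \<bullet> b) U"
      using Suc.prems by (intro Ck_on_bounded_linear[OF assms(1) bounded_linear_inner_left]) simp
    show "Ck_on k (\<lambda>x. ?g' (f x) b) U"
      using Suc.prems by (intro Suc.IH Ck_on_SucD[OF Suc.prems(1)]) simp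
  qed
  moreover have "(\<Sum>b\<in>Basis. (?f' x v \<bullet> b) *\<^sub>R ?g' (f x) b) = ?g' (f x) (?f' x v)"
    if "x \<in> U" for x v
    by (rule linear_apply_basis[OF has_derivative_linear[OF g'[OF that]], symmetric])
  ultimately have "Ck_on k (\<lambda>x. ?g' (f x) (?f' x v)) U" for v
    by (rule Ck_on_cong[OF assms(1), rotated])
  then show ?case
    by (intro Ck_on_SucI[OF assms(1), where f' = "\<lambda>x v. ?g' (f x) (?f' x v)"])
      (auto intro!: has_derivative_compose[OF f' g'])
qed

section \<open>Symmetry of second derivatives\<close>

abbreviation second_derivative ::
  "('x::euclidean_space \<Rightarrow> 'y::real_normed_vector) \<Rightarrow> 'x \<Rightarrow> 'x \<Rightarrow> 'x \<Rightarrow> 'y" where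
  "second_derivative f x u v \<equiv>
     frechet_derivative (\<lambda>y. frechet_derivative f (at y) v) (at x) u"

text \<open>The mean value theorem is used twice, first in direction \<open>u\<close> for the
  difference of \<open>f\<close> along two parallel segments, then in direction \<open>v\<close> for
  the resulting first derivative. The second difference does not change when \<open>u\<close> and
  \<open>v\<close> are exchanged, which is what makes the result useful.\<close>

lemma second_difference_mvt:
  fixes f :: "'x::euclidean_space \<Rightarrow> real"
  assumes C2: "Ck_on 2 f (ball x r)" and h: "h > 0" "h * (norm u + norm v) < r"
  shows "\<exists>y\<in>ball x r. f (x + h *\<^sub>R u + h *\<^sub>R v) - f (x + h *\<^sub>R u) - f (x + h *\<^sub>R v) + f x
           = h^2 * second_derivative f y v u"
proof -
  have inb: "x + s *\<^sub>R u + t *\<^sub>R v \<in> ball x r" if "0 \<le> s" "s \<le> h" "0 \<le> t" "t \<le> h" for s t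
  proof -
    have "norm (s *\<^sub>R u + t *\<^sub>R v) \<le> s * norm u + t * norm v"
      using norm_triangle_ineq[of "s *\<^sub>R u" "t *\<^sub>R v"] that by simp
    also have "\<dots> \<le> h * norm u + h * norm v"
      using that by (intro add_mono mult_right_mono) auto
    also have "\<dots> < r" using h by (simp add: algebra_simps)
    finally have "norm (s *\<^sub>R u + t *\<^sub>R v) < r" .
    moreover have "dist x (x + s *\<^sub>R u + t *\<^sub>R v) = norm (s *\<^sub>R u + t *\<^sub>R v)"
      unfolding add.assoc using norm_minus_cancel[of "s *\<^sub>R u + t *\<^sub>R v"] by (simp add: dist_norm)
    ultimately show ?thesis by simp
  qed
  have C2': "Ck_on (Suc (Suc 0)) f (ball x r)" using C2 by (simp add: numeral_2_eq_2)
  let ?D = "\<lambda>y. frechet_derivative f (at y)"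
  have D: "(f has_derivative ?D y) (at y)" if "y \<in> ball x r" for y
    using Ck_on_Suc_has_derivative[OF C2' that] .
  have "Ck_on (Suc 0) (\<lambda>y. ?D y u) (ball x r)" using C2' by (subst (asm) Ck_on.simps) blast
  then have D2: "((\<lambda>y. ?D y u) has_derivative (\<lambda>w. second_derivative f y w u)) (at y)"
    if "y \<in> ball x r" for y
    using Ck_on_Suc_has_derivative that by blast
  let ?\<phi> = "\<lambda>s. f (x + s *\<^sub>R u + h *\<^sub>R v) - f (x + s *\<^sub>R u + 0 *\<^sub>R v)"
  have sl: "((\<lambda>s. f (x + s *\<^sub>R u + t *\<^sub>R v)) has_derivative
      (\<lambda>e. ?D (x + s *\<^sub>R u + t *\<^sub>R v) (e *\<^sub>R u))) (at s within {0..h})"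
    if "0 \<le> s" "s \<le> h" "0 \<le> t" "t \<le> h" for s t
    by (rule has_derivative_compose[of "\<lambda>s. x + s *\<^sub>R u + t *\<^sub>R v" "\<lambda>e. e *\<^sub>R u" _ _ f,
          OF _ D[OF inb[OF that]]]) (auto intro!: derivative_eq_intros)
  have lin: "linear (?D y)" if "y \<in> ball x r" for y using D[OF that] has_derivative_linear by blast
  have "\<exists>s\<in>{0<..<h}. ?\<phi> h - ?\<phi> 0 = (\<lambda>e. ?D (x + s *\<^sub>R u + h *\<^sub>R v) (e *\<^sub>R u)
      - ?D (x + s *\<^sub>R u + 0 *\<^sub>R v) (e *\<^sub>R u)) (h - 0)"
    using h by (intro mvt_simple has_derivative_diff sl) auto
  then obtain s where s: "0 < s" "s < h" and
    1: "?\<phi> h - ?\<phi> 0 = ?D (x + s *\<^sub>R u + h *\<^sub>R v) (h *\<^sub>R u) - ?D (x + s *\<^sub>R u + 0 *\<^sub>R v) (h *\<^sub>R u)"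
    by auto
  have 2: "?\<phi> h - ?\<phi> 0 = h * (?D (x + s *\<^sub>R u + h *\<^sub>R v) u - ?D (x + s *\<^sub>R u + 0 *\<^sub>R v) u)"
    unfolding 1 using s h lin[OF inb[of s h]] lin[OF inb[of s 0]]
    by (simp add: linear_scale right_diff_distrib)
  have sl2: "((\<lambda>t. ?D (x + s *\<^sub>R u + t *\<^sub>R v) u) has_derivative
      (\<lambda>e. second_derivative f (x + s *\<^sub>R u + t *\<^sub>R v) (e *\<^sub>R v) u)) (at t within {0..h})"
    if "0 \<le> t" "t \<le> h" for t
    by (rule has_derivative_compose[of "\<lambda>t. x + s *\<^sub>R u + t *\<^sub>R v" "\<lambda>e. e *\<^sub>R v" _ _
          "\<lambda>y. frechet_derivative f (at y) u", OF _ D2[OF inb]])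
      (use s that in \<open>auto intro!: derivative_eq_intros\<close>)
  have "\<exists>t\<in>{0<..<h}. ?D (x + s *\<^sub>R u + h *\<^sub>R v) u - ?D (x + s *\<^sub>R u + 0 *\<^sub>R v) u
      = (\<lambda>e. second_derivative f (x + s *\<^sub>R u + t *\<^sub>R v) (e *\<^sub>R v) u) (h - 0)"
    using h sl2 by (intro mvt_simple) auto
  then obtain t where t: "0 < t" "t < h" and
    3: "?D (x + s *\<^sub>R u + h *\<^sub>R v) u - ?D (x + s *\<^sub>R u + 0 *\<^sub>R v) u
      = second_derivative f (x + s *\<^sub>R u + t *\<^sub>R v) (h *\<^sub>R v) u"
    by auto
  let ?y = "x + s *\<^sub>R u + t *\<^sub>R v"
  have y: "?y \<in> ball x r" using inb s t by simp
  have "linear (\<lambda>w. second_derivative f ?y w u)" using D2[OF y] has_derivative_linear by blast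
  from linear_scale[OF this, of h v] 2 3
  have "?\<phi> h - ?\<phi> 0 = h^2 * second_derivative f ?y v u" by (simp add: power2_eq_square)
  then show ?thesis using y by (intro bexI[of _ ?y]) (auto simp: algebra_simps)
qed

lemma second_derivative_symmetric_real:
  fixes f :: "'x::euclidean_space \<Rightarrow> real"
  assumes "open U" "Ck_on 2 f U" "x \<in> U"
  shows "second_derivative f x u v = second_derivative f x v u"
proof (rule ccontr)
  assume ne: "\<not> ?thesis"
  \<comment> \<open>Half the gap: numbers less than \<open>\<epsilon>\<close> away from the two
    mixed derivatives at \<open>x\<close> cannot coincide, yet the second difference produces such a
    coincidence.\<close>
  define \<epsilon> where "\<epsilon> = \<bar>second_derivative f x u v - second_derivative f x v u\<bar> / 2"
  have \<epsilon>: "\<epsilon> > 0" using ne by (simp add: \<epsilon>_def)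
  have "Ck_on 0 (\<lambda>y. second_derivative f y a b) U" for a b
    using assms(2) unfolding numeral_2_eq_2 by (subst (asm) Ck_on.simps, subst (asm) Ck_on.simps) blast
  then have cont: "isCont (\<lambda>y. second_derivative f y a b) x" for a b
    using assms(1,3) by (simp add: continuous_on_eq_continuous_at)
  have "\<forall>\<^sub>F y in nhds x. \<bar>second_derivative f y a b - second_derivative f x a b\<bar> < \<epsilon>" for a b
  proof -
    have "((\<lambda>y. second_derivative f y a b) \<longlongrightarrow> second_derivative f x a b) (nhds x)"
      using cont[unfolded isCont_def] tendsto_at_iff_tendsto_nhds[of "\<lambda>y. second_derivative f y a b" x]
      by simp
    from tendstoD[OF this \<epsilon>] show ?thesis by (simp add: dist_real_def)
  qed
  then have "\<forall>\<^sub>F y in nhds x. \<bar>second_derivative f y u v - second_derivative f x u v\<bar> < \<epsilon> \<and>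
      \<bar>second_derivative f y v u - second_derivative f x v u\<bar> < \<epsilon> \<and> y \<in> U"
    using assms(1,3) by (intro eventually_conj eventually_nhds_in_open) auto
  then obtain r where r: "r > 0" and
    B: "\<And>y. y \<in> ball x r \<Longrightarrow> \<bar>second_derivative f y u v - second_derivative f x u v\<bar> < \<epsilon> \<and>
      \<bar>second_derivative f y v u - second_derivative f x v u\<bar> < \<epsilon> \<and> y \<in> U"
    unfolding eventually_nhds_metric by (auto simp: dist_commute)
  \<comment> \<open>The summand 1 keeps the denominator positive even for \<open>u = v = 0\<close>
    and makes the required bound strict.\<close>
  define h where "h = r / (norm u + norm v + 1)"
  have pos: "norm u + norm v + 1 > 0" by (smt (verit) norm_ge_zero)
  have h: "h > 0" "h * (norm u + norm v) < r"
    using r pos by (simp_all add: h_def divide_simps)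
  have C2: "Ck_on 2 f (ball x r)" using Ck_on_subset[OF assms(2)] B by blast
  have C2': "h * (norm v + norm u) < r" using h(2) by (simp add: add.commute)
  obtain y where y: "y \<in> ball x r"
    "f (x + h *\<^sub>R u + h *\<^sub>R v) - f (x + h *\<^sub>R u) - f (x + h *\<^sub>R v) + f x
       = h^2 * second_derivative f y v u"
    using second_difference_mvt[OF C2 h] by blast
  obtain z where z: "z \<in> ball x r"
    "f (x + h *\<^sub>R v + h *\<^sub>R u) - f (x + h *\<^sub>R v) - f (x + h *\<^sub>R u) + f x
       = h^2 * second_derivative f z u v"
    using second_difference_mvt[OF C2 h(1) C2'] by blast
  have "x + h *\<^sub>R v + h *\<^sub>R u = x + h *\<^sub>R u + h *\<^sub>R v" by (simp add: algebra_simps)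
  from y(2) z(2)[unfolded this]
  have "h^2 * second_derivative f y v u = h^2 * second_derivative f z u v" by linarith
  then have "second_derivative f y v u = second_derivative f z u v" using h(1) by simp
  with B[OF y(1)] B[OF z(1)] show False unfolding \<epsilon>_def by (simp add: abs_if split: if_splits)
qed

lemma second_derivative_symmetric:
  fixes f :: "'x::euclidean_space \<Rightarrow> 'y::euclidean_space"
  assumes "open U" "Ck_on 2 f U" "x \<in> U"
  shows "second_derivative f x u v = second_derivative f x v u"
proof (rule euclidean_eqI)
  fix b :: 'y
  have C: "Ck_on (Suc (Suc 0)) f U" using assms(2) by (simp only: numeral_2_eq_2)
  let ?D = "\<lambda>y. frechet_derivative f (at y)"
  have Cb: "Ck_on 2 (\<lambda>y. f y \<bullet> b) U"
    by (rule Ck_on_bounded_linear[OF assms(1) bounded_linear_inner_left assms(2)])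
  have 1: "frechet_derivative (\<lambda>y. f y \<bullet> b) (at y) w = ?D y w \<bullet> b" if "y \<in> U" for y w
  proof -
    have "((\<lambda>y. f y \<bullet> b) has_derivative (\<lambda>w. ?D y w \<bullet> b)) (at y)"
      by (intro has_derivative_inner_left Ck_on_Suc_has_derivative[OF C that])
    then show ?thesis using frechet_derivative_at by metis
  qed
  have 2: "second_derivative (\<lambda>y. f y \<bullet> b) x w w' = second_derivative f x w w' \<bullet> b" for w w'
  proof -
    have "Ck_on (Suc 0) (\<lambda>y. ?D y w') U" using C by (subst (asm) Ck_on.simps) blast
    then have "((\<lambda>y. ?D y w' \<bullet> b) has_derivative (\<lambda>w. second_derivative f x w w' \<bullet> b)) (at x)"
      by (intro has_derivative_inner_left Ck_on_Suc_has_derivative[OF _ assms(3)])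
    then have "((\<lambda>y. frechet_derivative (\<lambda>y. f y \<bullet> b) (at y) w') has_derivative
        (\<lambda>w. second_derivative f x w w' \<bullet> b)) (at x)"
      by (rule has_derivative_transform_within_open[OF _ assms(1,3)]) (simp add: 1)
    then show ?thesis using frechet_derivative_at by metis
  qed
  show "second_derivative f x u v \<bullet> b = second_derivative f x v u \<bullet> b"
    using second_derivative_symmetric_real[OF assms(1) Cb assms(3)] by (simp add: 2)
qed

section \<open>Smoothness on sets that need not be open\<close>

lemma smooth_onE:
  assumes "smooth_on f S" "x \<in> S"
  obtains U h where "open U" "x \<in> U" "\<And>k. Ck_on k h U" "\<And>y. y \<in> S \<Longrightarrow> y \<in> U \<Longrightarrow> h y = f y"
proof -
  obtain U h where "open U \<and> x \<in> U \<and> (\<forall>k. Ck_on k h U) \<and> (\<forall>y\<in>S \<inter> U. h y = f y)"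
    using bspec[OF assms(1)[unfolded smooth_on_def] assms(2)] by (elim exE)
  then show thesis by (intro that[of U h]) simp_all
qed

lemma smooth_onI:
  assumes "\<And>x. x \<in> S \<Longrightarrow> \<exists>U h. open U \<and> x \<in> U \<and> (\<forall>k. Ck_on k h U) \<and> (\<forall>y\<in>S \<inter> U. h y = f y)"
  shows "smooth_on f S"
  using assms by (simp add: smooth_on_def)

lemma smooth_on_subset:
  assumes "smooth_on f S" "T \<subseteq> S"
  shows "smooth_on f T"
proof (rule smooth_onI)
  fix x assume "x \<in> T"
  then have "x \<in> S" using assms(2) by blast
  from smooth_onE[OF assms(1) this]
  obtain U h where "open U" "x \<in> U" "\<And>k. Ck_on k h U" "\<And>y. y \<in> S \<Longrightarrow> y \<in> U \<Longrightarrow> h y = f y"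
    by metis
  then show "\<exists>U h. open U \<and> x \<in> U \<and> (\<forall>k. Ck_on k h U) \<and> (\<forall>y\<in>T \<inter> U. h y = f y)"
    using assms(2) by (intro exI[of _ U] exI[of _ h]) auto
qed

lemma smooth_on_cong:
  assumes "\<And>x. x \<in> S \<Longrightarrow> f x = g x" "smooth_on f S"
  shows "smooth_on g S"
proof (rule smooth_onI)
  fix x assume "x \<in> S"
  from smooth_onE[OF assms(2) this]
  obtain U h where "open U" "x \<in> U" "\<And>k. Ck_on k h U" "\<And>y. y \<in> S \<Longrightarrow> y \<in> U \<Longrightarrow> h y = f y"
    by metis
  then show "\<exists>U h. open U \<and> x \<in> U \<and> (\<forall>k. Ck_on k h U) \<and> (\<forall>y\<in>S \<inter> U. h y = g y)"
    using assms(1) by (intro exI[of _ U] exI[of _ h]) auto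
qed

lemma smooth_on_local:
  assumes "\<And>x. x \<in> S \<Longrightarrow> \<exists>T. openin (top_of_set S) T \<and> x \<in> T \<and> smooth_on f T"
  shows "smooth_on f S"
proof (rule smooth_onI)
  fix x assume "x \<in> S"
  then obtain T where T: "openin (top_of_set S) T" "x \<in> T" "smooth_on f T" using assms by blast
  then obtain V where V: "open V" "T = S \<inter> V" by (auto simp: openin_open)
  from smooth_onE[OF T(3,2)]
  obtain U h where "open U" "x \<in> U" "\<And>k. Ck_on k h U" "\<And>y. y \<in> T \<Longrightarrow> y \<in> U \<Longrightarrow> h y = f y"
    by metis
  then show "\<exists>U h. open U \<and> x \<in> U \<and> (\<forall>k. Ck_on k h U) \<and> (\<forall>y\<in>S \<inter> U. h y = f y)"
    using V T(2) by (intro exI[of _ "U \<inter> V"] exI[of _ h]) (auto intro: Ck_on_subset)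
qed

lemma smooth_on_compose:
  fixes f :: "'x::euclidean_space \<Rightarrow> 'y::euclidean_space"
    and g :: "'y \<Rightarrow> 'z::real_normed_vector"
  assumes f: "smooth_on f S" and g: "smooth_on g T" and fS: "f ` S \<subseteq> T"
  shows "smooth_on (g \<circ> f) S"
proof (rule smooth_onI)
  fix x assume x: "x \<in> S"
  from smooth_onE[OF f x]
  obtain U f' where U: "open U" "x \<in> U" "\<And>k. Ck_on k f' U" "\<And>y. y \<in> S \<Longrightarrow> y \<in> U \<Longrightarrow> f' y = f y"
    by metis
  have "f x \<in> T" using fS x by blast
  from smooth_onE[OF g this]
  obtain V g' where V: "open V" "f x \<in> V" "\<And>k. Ck_on k g' V" "\<And>y. y \<in> T \<Longrightarrow> y \<in> V \<Longrightarrow> g' y = g y"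
    by metis
  define W where "W = U \<inter> f' -` V"
  have W: "open W" using continuous_open_preimage[OF Ck_on_continuous_on[OF U(3)] U(1) V(1)]
    by (simp add: W_def)
  have "Ck_on k (\<lambda>y. g' (f' y)) W" for k
    using Ck_on_compose[OF W _ Ck_on_subset[OF U(3)] V(3)] by (auto simp: W_def)
  moreover have "x \<in> W" using U V x by (auto simp: W_def)
  moreover have "\<forall>y\<in>S \<inter> W. g' (f' y) = (g \<circ> f) y" using U(4) V(4) fS by (auto simp: W_def)
  ultimately show "\<exists>U h. open U \<and> x \<in> U \<and> (\<forall>k. Ck_on k h U) \<and> (\<forall>y\<in>S \<inter> U. h y = (g \<circ> f) y)"
    using W by blast
qed

section \<open>Derivatives within relatively open subsets of half-spaces\<close>

lemma at_within_openin:
  assumes "openin (top_of_set S) T" "x \<in> T"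
  shows "at x within T = at x within S"
proof -
  obtain V where "open V" "T = S \<inter> V" using assms(1) by (auto simp: openin_open)
  then show ?thesis using assms(2) at_within_nhd[of x V T S] by blast
qed

definition halfspace_open :: "'e::euclidean_space set \<Rightarrow> bool" where
  "halfspace_open S \<longleftrightarrow> (\<exists>h. openin (top_of_set {x. 0 \<le> h \<bullet> x}) S)"

text \<open>Along each basis vector at least one sign of a small increment stays in the half-space,
  and arbitrarily small increments in every basis direction determine the derivative.\<close>

lemma halfspace_open_derivative_unique:
  assumes S: "halfspace_open S" "x \<in> S"
    and f: "(f has_derivative f') (at x within S)" "(f has_derivative f'') (at x within S)"
  shows "f' = f''"
proof (rule frechet_derivative_unique_within[OF f])
  fix i :: 'a and e :: real
  assume i: "i \<in> Basis" and e: "0 < e"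
  obtain h V where V: "open V" "S = {x. 0 \<le> h \<bullet> x} \<inter> V"
    using S(1) by (auto simp: halfspace_open_def openin_open)
  obtain r where r: "r > 0" "ball x r \<subseteq> V" using V S(2) openE by blast
  \<comment> \<open>The sign is chosen so that \<open>d * (h \<bullet> i)\<close> is nonnegative;
    halving \<open>min e r\<close> gives both strict bounds.\<close>
  define d where "d = (if h \<bullet> i \<ge> 0 then min e r / 2 else - (min e r / 2))"
  have d: "0 < \<bar>d\<bar>" "\<bar>d\<bar> < e" "\<bar>d\<bar> < r" "0 \<le> d * (h \<bullet> i)"
    using e r(1) by (auto simp: d_def mult_le_0_iff zero_le_mult_iff)
  have "x + d *\<^sub>R i \<in> ball x r" using d i by (simp add: dist_norm)
  then have "x + d *\<^sub>R i \<in> S" using r d(4) V S(2) by (auto simp: inner_add_right)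
  then show "\<exists>d. 0 < \<bar>d\<bar> \<and> \<bar>d\<bar> < e \<and> x + d *\<^sub>R i \<in> S" using d by blast
qed

lemma halfspace_open_frechet_derivative:
  assumes "halfspace_open S" "x \<in> S" "(f has_derivative f') (at x within S)"
  shows "frechet_derivative f (at x within S) = f'"
  using halfspace_open_derivative_unique[OF assms(1,2) _ assms(3)] assms(3)
  by (metis differentiable_def frechet_derivative_works)

text \<open>Near \<open>x\<close> the map is the restriction of a smooth \<open>h\<close> on an open
  set. By uniqueness its derivatives within \<open>S\<close> are those of \<open>h\<close>, also at
  nearby points of \<open>S\<close>, so the second derivative within \<open>S\<close> is the
  symmetric Hessian of \<open>h\<close>. The set \<open>T\<close> is kept apart from
  \<open>S\<close> because a map read in charts is known to be smooth on only a part of the chart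
  image, while derivatives are taken within all of it.\<close>

lemma smooth_on_frechet_derivatives:
  fixes f :: "'x::euclidean_space \<Rightarrow> 'y::euclidean_space"
  assumes S: "halfspace_open S" and T: "openin (top_of_set S) T"
    and f: "smooth_on f T" and x: "x \<in> T"
  shows "(f has_derivative frechet_derivative f (at x within S)) (at x within S)"
    and "\<exists>f''. (\<forall>v. ((\<lambda>y. frechet_derivative f (at y within S) v) has_derivative (\<lambda>u. f'' u v))
            (at x within S)) \<and> (\<forall>u v. f'' u v = f'' v u)"
proof -
  from smooth_onE[OF f x]
  obtain U h where U: "open U" "x \<in> U" "\<And>k. Ck_on k h U" "\<And>y. y \<in> T \<Longrightarrow> y \<in> U \<Longrightarrow> h y = f y"
    by metis
  obtain V where V: "open V" "T = S \<inter> V" using T by (auto simp: openin_open)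
  define W where "W = S \<inter> (U \<inter> V)"
  have W: "openin (top_of_set S) W" "x \<in> W"
    using U(1,2) V x by (auto simp: openin_open W_def)
  have D: "(f has_derivative frechet_derivative h (at y)) (at y within S)" if "y \<in> W" for y
  proof -
    have y: "y \<in> U" "y \<in> S" "y \<in> U \<inter> V" using that by (auto simp: W_def)
    have "(h has_derivative frechet_derivative h (at y)) (at y within S)"
      using Ck_on_Suc_has_derivative[OF U(3) y(1)] has_derivative_at_withinI by blast
    moreover have "\<forall>\<^sub>F z in at y within S. h z = f z"
      using U(1,4) V y by (auto simp: eventually_at_topological intro!: exI[of _ "U \<inter> V"])
    moreover have "h y = f y" using U(4) V y by auto
    ultimately show ?thesis using has_derivative_transform_eventually y(2) by blast
  qed
  have fr: "frechet_derivative f (at y within S) = frechet_derivative h (at y)" if "y \<in> W" for y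
    using halfspace_open_frechet_derivative[OF S _ D[OF that]] that by (simp add: W_def)
  show "(f has_derivative frechet_derivative f (at x within S)) (at x within S)"
    using D[OF W(2)] fr[OF W(2)] by simp
  have C: "Ck_on (Suc (Suc 0)) h U" using U(3) .
  have D2: "((\<lambda>y. frechet_derivative f (at y within S) v) has_derivative
      (\<lambda>u. second_derivative h x u v)) (at x within S)" for v
  proof -
    have "Ck_on (Suc 0) (\<lambda>y. frechet_derivative h (at y) v) U"
      using C by (subst (asm) Ck_on.simps) blast
    then have "((\<lambda>y. frechet_derivative h (at y) v) has_derivative
        (\<lambda>u. second_derivative h x u v)) (at x within S)"
      using Ck_on_Suc_has_derivative[OF _ U(2)] has_derivative_at_withinI by blast
    moreover have "\<forall>\<^sub>F z in at x within S.
        frechet_derivative h (at z) v = frechet_derivative f (at z within S) v"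
      unfolding eventually_at_topological
      using U(1) V W(2) fr by (intro exI[of _ "U \<inter> V"]) (auto simp: W_def)
    moreover have "frechet_derivative h (at x) v = frechet_derivative f (at x within S) v"
      using fr[OF W(2)] by simp
    moreover have "x \<in> S" using W(2) by (simp add: W_def)
    ultimately show ?thesis by (rule has_derivative_transform_eventually)
  qed
  show "\<exists>f''. (\<forall>v. ((\<lambda>y. frechet_derivative f (at y within S) v) has_derivative (\<lambda>u. f'' u v))
            (at x within S)) \<and> (\<forall>u v. f'' u v = f'' v u)"
    using D2 second_derivative_symmetric[OF U(1) U(3) U(2)]
    by (intro exI[of _ "second_derivative h x"] conjI) auto
qed

subsection \<open>Charts and differentials\<close>

lemma chart_openin: "smooth_manifold M \<Longrightarrow> c \<in> atlas M \<Longrightarrow> openin (mtop M) (fst c)"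
  by (simp add: smooth_manifold_def is_chart_def)

lemma chart_subset_pts: "smooth_manifold M \<Longrightarrow> c \<in> atlas M \<Longrightarrow> fst c \<subseteq> pts M"
  by (simp add: chart_openin openin_subset)

lemma chart_homeomorphic_map:
  "smooth_manifold M \<Longrightarrow> c \<in> atlas M \<Longrightarrow>
     homeomorphic_map (subtopology (mtop M) (fst c)) (top_of_set (chart_image c)) (snd c)"
  by (simp add: smooth_manifold_def is_chart_def)

lemma chart_inj_on:
  assumes "smooth_manifold M" "c \<in> atlas M"
  shows "inj_on (snd c) (fst c)"
proof -
  have "topspace (subtopology (mtop M) (fst c)) = fst c"
    using chart_subset_pts[OF assms] by auto
  then show ?thesis using homeomorphic_imp_injective_map[OF chart_homeomorphic_map[OF assms]] by simp
qed

lemma chart_halfspace_open: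
  "smooth_manifold M \<Longrightarrow> c \<in> atlas M \<Longrightarrow> halfspace_open (chart_image c)"
  unfolding smooth_manifold_def is_chart_def halfspace_open_def by blast

lemma chart_inv_chart:
  "smooth_manifold M \<Longrightarrow> c \<in> atlas M \<Longrightarrow> p \<in> fst c \<Longrightarrow> chart_inv c (snd c p) = p"
  by (simp add: chart_inv_def chart_inj_on)

lemma chart_chart_inv: "x \<in> chart_image c \<Longrightarrow> snd c (chart_inv c x) = x"
  by (simp add: chart_inv_def chart_image_def f_inv_into_f)

lemma chart_in_image: "p \<in> fst c \<Longrightarrow> snd c p \<in> chart_image c"
  by (simp add: chart_image_def)

lemma chart_at:
  assumes "smooth_manifold M" "p \<in> pts M"
  shows "chart_at M p \<in> atlas M" "p \<in> fst (chart_at M p)"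
proof -
  have "\<exists>c. c \<in> atlas M \<and> p \<in> fst c" using assms unfolding smooth_manifold_def by blast
  then have "chart_at M p \<in> atlas M \<and> p \<in> fst (chart_at M p)"
    unfolding chart_at_def by (rule someI_ex)
  then show "chart_at M p \<in> atlas M" "p \<in> fst (chart_at M p)" by auto
qed

lemma chart_image_openin:
  assumes "smooth_manifold M" "c \<in> atlas M" "openin (mtop M) V"
  shows "openin (top_of_set (chart_image c)) (snd c ` (fst c \<inter> V))"
proof -
  have "openin (subtopology (mtop M) (fst c)) (fst c \<inter> V)"
    using assms(3) by (simp add: openin_subtopology_Int2)
  then show ?thesis
    using homeomorphic_map_openness_eq[OF chart_homeomorphic_map[OF assms(1,2)]] by blast
qed

lemma boundaryless_chart_open:
  assumes "mboundary M = {}" "smooth_manifold M" "c \<in> atlas M"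
  shows "open (chart_image c)"
proof -
  have "x \<in> interior (chart_image c)" if x: "x \<in> chart_image c" for x
  proof -
    obtain p where p: "p \<in> fst c" "x = snd c p" using x by (auto simp: chart_image_def)
    have "p \<in> mboundary M" if "snd c p \<notin> interior (chart_image c)"
      using p(1) that assms(3) chart_subset_pts[OF assms(2,3)] by (auto simp: mboundary_def)
    then show ?thesis using p(2) assms(1) by blast
  qed
  then have "interior (chart_image c) = chart_image c" using interior_subset by blast
  then show ?thesis by (metis open_interior)
qed

text \<open>Both \<open>mderiv\<close> and \<open>transition\<close> are instances, the latter with
  \<open>f = id\<close>, so a single chain rule covers composition of differentials and change of
  charts.\<close>

abbreviation chart_deriv ::
  "('a, 'e::euclidean_space) chart \<Rightarrow> ('a \<Rightarrow> 'b) \<Rightarrow> ('b, 'f::euclidean_space) chart \<Rightarrow> 'a \<Rightarrow> 'e \<Rightarrow> 'f" where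
  "chart_deriv c f d p \<equiv>
     frechet_derivative (snd d \<circ> f \<circ> chart_inv c) (at (snd c p) within chart_image c)"

abbreviation chart_domain ::
  "('a, 'e) chart \<Rightarrow> ('a \<Rightarrow> 'b) \<Rightarrow> ('b, 'f) chart \<Rightarrow> 'e set" where
  "chart_domain c f d \<equiv> snd c ` (fst c \<inter> f -` fst d)"

lemma chart_domainD:
  assumes "smooth_manifold M" "c \<in> atlas M" "x \<in> chart_domain c f d"
  shows "chart_inv c x \<in> fst c" "chart_inv c x \<in> pts M" "f (chart_inv c x) \<in> fst d"
    "snd c (chart_inv c x) = x" "x \<in> chart_image c"
  using assms chart_inv_chart[OF assms(1,2)] chart_subset_pts[OF assms(1,2)]
  by (auto simp: chart_in_image)

lemma transition_eq_chart_deriv: "transition c d p = chart_deriv c id d p"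
  by (simp add: transition_def)

lemma mderiv_eq_chart_deriv:
  "mderiv M N f p = chart_deriv (chart_at M p) f (chart_at N (f p)) p"
  by (simp add: mderiv_def Let_def)

lemma smooth_map_continuous_map: "smooth_map M N f \<Longrightarrow> continuous_map (mtop M) (mtop N) f"
  by (simp add: smooth_map_on_def)

lemma smooth_map_in_pts: "smooth_map M N f \<Longrightarrow> p \<in> pts M \<Longrightarrow> f p \<in> pts N"
  using smooth_map_continuous_map by (metis continuous_map_image_subset_topspace image_subset_iff)

lemma chart_domain_openin:
  assumes "smooth_manifold M" "smooth_manifold N" "continuous_map (mtop M) (mtop N) f"
    "c \<in> atlas M" "d \<in> atlas N"
  shows "openin (top_of_set (chart_image c)) (chart_domain c f d)"
proof -
  have "openin (mtop M) {x \<in> pts M. f x \<in> fst d}"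
    using openin_continuous_map_preimage[OF assms(3) chart_openin[OF assms(2,5)]] .
  moreover have "fst c \<inter> {x \<in> pts M. f x \<in> fst d} = fst c \<inter> f -` fst d"
    using chart_subset_pts[OF assms(1,4)] by auto
  ultimately show ?thesis using chart_image_openin[OF assms(1,4)] by metis
qed

lemma smooth_map_smooth_on:
  assumes "smooth_manifold M" "smooth_map M N f" "c \<in> atlas M" "d \<in> atlas N"
  shows "smooth_on (snd d \<circ> f \<circ> chart_inv c) (chart_domain c f d)"
proof -
  have "fst c \<inter> pts M = fst c" using chart_subset_pts[OF assms(1,3)] by auto
  then show ?thesis using assms(2-4) by (auto simp: smooth_map_on_def)
qed

locale smooth_maps_between =
  fixes M :: "('a, 'e::euclidean_space) mfd" and N :: "('b, 'f::euclidean_space) mfd"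
    and f :: "'a \<Rightarrow> 'b"
  assumes smooth_source: "smooth_manifold M" and smooth_target: "smooth_manifold N"
    and smooth_map: "smooth_map M N f"
begin

lemma in_pts: "p \<in> pts M \<Longrightarrow> f p \<in> pts N"
  using smooth_map_in_pts[OF smooth_map] .

lemma domain_openin:
  "c \<in> atlas M \<Longrightarrow> d \<in> atlas N \<Longrightarrow> openin (top_of_set (chart_image c)) (chart_domain c f d)"
  using chart_domain_openin[OF smooth_source smooth_target smooth_map_continuous_map[OF smooth_map]] .

context
  fixes c :: "('a, 'e) chart" and d :: "('b, 'f) chart" and p :: 'a
  assumes c: "c \<in> atlas M" "p \<in> fst c" and d: "d \<in> atlas N" "f p \<in> fst d"
begin

lemma chart_has_derivative:
  "((snd d \<circ> f \<circ> chart_inv c) has_derivative chart_deriv c f d p)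
     (at (snd c p) within chart_image c)"
  by (rule smooth_on_frechet_derivatives(1)[OF chart_halfspace_open[OF smooth_source c(1)]
        domain_openin[OF c(1) d(1)] smooth_map_smooth_on[OF smooth_source smooth_map c(1) d(1)]])
    (use c d in auto)

lemma chart_deriv_linear: "linear (chart_deriv c f d p)"
  using chart_has_derivative has_derivative_linear by blast

lemma chart_second_derivative:
  "\<exists>D2. (\<forall>v. ((\<lambda>y. frechet_derivative (snd d \<circ> f \<circ> chart_inv c) (at y within chart_image c) v)
        has_derivative (\<lambda>u. D2 u v)) (at (snd c p) within chart_image c)) \<and>
      (\<forall>u v. D2 u v = D2 v u)"
  by (rule smooth_on_frechet_derivatives(2)[OF chart_halfspace_open[OF smooth_source c(1)]
        domain_openin[OF c(1) d(1)] smooth_map_smooth_on[OF smooth_source smooth_map c(1) d(1)]])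
    (use c d in auto)

end

lemma mderiv_linear: "p \<in> pts M \<Longrightarrow> linear (mderiv M N f p)"
  unfolding mderiv_eq_chart_deriv
  by (intro chart_deriv_linear chart_at[OF smooth_source] chart_at[OF smooth_target] in_pts)

end

section \<open>Composition and the chain rule on manifolds\<close>

text \<open>Equality of \<open>h\<close> with the composite is asked for on \<open>pts L\<close>
  alone, because the inclusion of \<Sigma> will be written as \<open>\<psi>\<close> after an inverse
  that is meaningful only on \<Sigma>.\<close>

lemma smooth_map_compose:
  assumes L: "smooth_manifold L" and M: "smooth_manifold M" and N: "smooth_manifold N"
    and \<beta>: "smooth_map L M \<beta>" and f: "smooth_map M N f"
    and h: "\<And>z. z \<in> pts L \<Longrightarrow> h z = f (\<beta> z)"
  shows "smooth_map L N h"
proof -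
  have cont: "continuous_map (mtop L) (mtop N) h"
    by (rule continuous_map_eq[OF continuous_map_compose[OF smooth_map_continuous_map[OF \<beta>]
            smooth_map_continuous_map[OF f]]]) (simp add: h)
  have "smooth_on (snd e \<circ> h \<circ> chart_inv c) (chart_domain c h e)"
    if c: "c \<in> atlas L" and e: "e \<in> atlas N" for c e
  proof (rule smooth_on_local)
    fix x assume "x \<in> chart_domain c h e"
    then obtain z where z: "z \<in> fst c" "h z \<in> fst e" "x = snd c z" by auto
    have zL: "z \<in> pts L" using z chart_subset_pts[OF L c] by auto
    \<comment> \<open>An intermediate chart around \<open>\<beta> z\<close>. The coordinate
      expression of \<open>h\<close> factors through it only where \<open>\<beta>\<close> lands in
      its domain, hence the passage to a relatively open piece.\<close>
    define d where "d = chart_at M (\<beta> z)"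
    have d: "d \<in> atlas M" "\<beta> z \<in> fst d"
      using chart_at[OF M smooth_map_in_pts[OF \<beta> zL]] by (auto simp: d_def)
    let ?T = "chart_domain c h e \<inter> chart_domain c \<beta> d"
    have op: "openin (top_of_set (chart_image c)) (chart_domain c h e)"
      "openin (top_of_set (chart_image c)) (chart_domain c \<beta> d)"
      using chart_domain_openin[OF L N cont c e]
        chart_domain_openin[OF L M smooth_map_continuous_map[OF \<beta>] c d(1)] by auto
    then have "openin (top_of_set (chart_image c)) ?T" by blast
    then have opT: "openin (top_of_set (chart_domain c h e)) ?T"
      using op(1) by (meson inf_le1 openin_imp_subset openin_subset_trans)
    have inT: "chart_inv c y \<in> fst c \<and> chart_inv c y \<in> pts L \<and> h (chart_inv c y) \<in> fst e \<and>
        \<beta> (chart_inv c y) \<in> fst d" if "y \<in> ?T" for y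
    proof -
      have y: "y \<in> chart_domain c h e" "y \<in> chart_domain c \<beta> d" using that by simp_all
      show ?thesis using chart_domainD[OF L c y(1)] chart_domainD[OF L c y(2)] by simp
    qed
    have "smooth_on ((snd e \<circ> f \<circ> chart_inv d) \<circ> (snd d \<circ> \<beta> \<circ> chart_inv c)) ?T"
    proof (rule smooth_on_compose)
      show "smooth_on (snd d \<circ> \<beta> \<circ> chart_inv c) ?T"
        using smooth_map_smooth_on[OF L \<beta> c d(1)] by (rule smooth_on_subset) simp
      show "smooth_on (snd e \<circ> f \<circ> chart_inv d) (chart_domain d f e)"
        using smooth_map_smooth_on[OF M f d(1) e] .
      show "(snd d \<circ> \<beta> \<circ> chart_inv c) ` ?T \<subseteq> chart_domain d f e"
      proof (rule image_subsetI)
        fix y assume "y \<in> ?T"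
        from inT[OF this] h have "\<beta> (chart_inv c y) \<in> fst d \<inter> f -` fst e" by auto
        then show "(snd d \<circ> \<beta> \<circ> chart_inv c) y \<in> chart_domain d f e"
          unfolding o_def by (rule imageI)
      qed
    qed
    moreover have "((snd e \<circ> f \<circ> chart_inv d) \<circ> (snd d \<circ> \<beta> \<circ> chart_inv c)) y
        = (snd e \<circ> h \<circ> chart_inv c) y" if "y \<in> ?T" for y
      using inT[OF that] chart_inv_chart[OF M d(1)] h by simp
    ultimately have "smooth_on (snd e \<circ> h \<circ> chart_inv c) ?T"
      using smooth_on_cong by blast
    moreover have "x \<in> ?T" using z d by auto
    ultimately show "\<exists>T. openin (top_of_set (chart_domain c h e)) T \<and> x \<in> T \<and>
        smooth_on (snd e \<circ> h \<circ> chart_inv c) T" using opT by blast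
  qed
  moreover have "fst c \<inter> pts L = fst c" if "c \<in> atlas L" for c
    using chart_subset_pts[OF L that] by auto
  ultimately show ?thesis using cont by (simp add: smooth_map_on_def)
qed

text \<open>The coordinate expressions compose on the set \<open>?T\<close> where
  \<open>\<beta>\<close> lands in the domain of \<open>d\<close>. Since \<open>?T\<close> is
  relatively open, derivatives within it and within the whole chart image agree.\<close>

lemma chart_deriv_compose:
  assumes L: "smooth_manifold L" and M: "smooth_manifold M" and N: "smooth_manifold N"
    and \<beta>: "smooth_map L M \<beta>" and f: "smooth_map M N f"
    and h: "\<And>z. z \<in> pts L \<Longrightarrow> h z = f (\<beta> z)"
    and c: "c \<in> atlas L" "p \<in> fst c" and d: "d \<in> atlas M" "\<beta> p \<in> fst d"
    and e: "e \<in> atlas N" "h p \<in> fst e"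
  shows "chart_deriv c h e p v = chart_deriv d f e (\<beta> p) (chart_deriv c \<beta> d p v)"
proof -
  interpret \<beta>: smooth_maps_between L M \<beta> by unfold_locales fact+
  interpret f: smooth_maps_between M N f by unfold_locales fact+
  have pL: "p \<in> pts L" using c chart_subset_pts[OF L] by blast
  let ?S = "chart_image c" and ?T = "chart_domain c \<beta> d" and ?b = "snd d \<circ> \<beta> \<circ> chart_inv c"
  have T: "openin (top_of_set ?S) ?T" "snd c p \<in> ?T" using \<beta>.domain_openin c d by auto
  have bp: "?b (snd c p) = snd d (\<beta> p)" using chart_inv_chart[OF L c] by simp
  have sub: "?b ` ?T \<subseteq> chart_image d"
    using chart_inv_chart[OF L c(1)] by (auto intro: chart_in_image)
  have fp: "f (\<beta> p) \<in> fst e" using e h[OF pL] by simp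
  have G: "(snd e \<circ> f \<circ> chart_inv d has_derivative chart_deriv d f e (\<beta> p))
      (at (?b (snd c p)) within ?b ` ?T)"
    using has_derivative_subset[OF f.chart_has_derivative[OF d e(1) fp] sub] bp by simp
  have F: "(?b has_derivative chart_deriv c \<beta> d p) (at (snd c p) within ?T)"
    using \<beta>.chart_has_derivative[OF c d] at_within_openin[OF T] by simp
  have "((\<lambda>x. (snd e \<circ> f \<circ> chart_inv d) (?b x)) has_derivative
      (\<lambda>v. chart_deriv d f e (\<beta> p) (chart_deriv c \<beta> d p v))) (at (snd c p) within ?T)"
    by (rule has_derivative_in_compose[OF F G])
  then have "((snd e \<circ> h \<circ> chart_inv c) has_derivative
      (\<lambda>v. chart_deriv d f e (\<beta> p) (chart_deriv c \<beta> d p v))) (at (snd c p) within ?T)"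
  proof (rule has_derivative_transform[rotated 2])
    show "(snd e \<circ> h \<circ> chart_inv c) x = (snd e \<circ> f \<circ> chart_inv d) (?b x)" if "x \<in> ?T" for x
      using that chart_inv_chart[OF L c(1)] chart_inv_chart[OF M d(1)] h chart_subset_pts[OF L c(1)]
      by auto
  qed (fact T)
  then have "((snd e \<circ> h \<circ> chart_inv c) has_derivative
      (\<lambda>v. chart_deriv d f e (\<beta> p) (chart_deriv c \<beta> d p v))) (at (snd c p) within ?S)"
    using at_within_openin[OF T] by simp
  then show ?thesis
    using halfspace_open_frechet_derivative[OF chart_halfspace_open[OF L c(1)] chart_in_image[OF c(2)]]
    by metis
qed

lemma smooth_map_id:
  assumes "smooth_manifold M"
  shows "smooth_map M M id"
proof -
  have "fst c \<inter> pts M \<inter> id -` fst d = fst c \<inter> fst d" if "c \<in> atlas M" "d \<in> atlas M" for c d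
    using chart_subset_pts[OF assms that(1)] by auto
  moreover have "smooth_on (snd d \<circ> chart_inv c) (snd c ` (fst c \<inter> fst d))"
    if "c \<in> atlas M" "d \<in> atlas M" for c d
    using assms that by (simp add: smooth_manifold_def smooth_compatible_def)
  ultimately show ?thesis unfolding smooth_map_on_def by (intro conjI ballI) simp_all
qed

lemma transition_self:
  assumes M: "smooth_manifold M" and c: "c \<in> atlas M" "p \<in> fst c"
  shows "transition c c p v = v"
proof -
  have "((\<lambda>x. x) has_derivative (\<lambda>v. v)) (at (snd c p) within chart_image c)"
    by (rule has_derivative_ident)
  then have "((snd c \<circ> chart_inv c) has_derivative (\<lambda>v. v)) (at (snd c p) within chart_image c)"
    by (rule has_derivative_transform[rotated 2]) (simp_all add: c chart_in_image chart_chart_inv)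
  then show ?thesis
    unfolding transition_def
    using halfspace_open_frechet_derivative[OF chart_halfspace_open[OF M c(1)] chart_in_image[OF c(2)]]
    by metis
qed

text \<open>The chain rule with outer map \<open>id\<close>: a change of target chart acts on
  differentials as it acts on tangent vectors.\<close>

lemma transition_chart_deriv:
  assumes M: "smooth_manifold M" and N: "smooth_manifold N" and h: "smooth_map M N h"
    and c: "c \<in> atlas M" "p \<in> fst c"
    and d: "d \<in> atlas N" "h p \<in> fst d" and e: "e \<in> atlas N" "h p \<in> fst e"
  shows "transition d e (h p) (chart_deriv c h d p v) = chart_deriv c h e p v"
  unfolding transition_eq_chart_deriv
  by (rule chart_deriv_compose[where h = h and f = id and \<beta> = h,
        OF M N N h smooth_map_id[OF N] _ c d e, symmetric]) simp

lemma transition_transition: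
  assumes M: "smooth_manifold M" and c: "c \<in> atlas M" "p \<in> fst c"
    and d: "d \<in> atlas M" "p \<in> fst d" and e: "e \<in> atlas M" "p \<in> fst e"
  shows "transition d e p (transition c d p v) = transition c e p v"
  using transition_chart_deriv[OF M M smooth_map_id[OF M] c, of d e v] d e
  by (simp add: transition_eq_chart_deriv)

lemma transition_linear:
  assumes "smooth_manifold M" "c \<in> atlas M" "p \<in> fst c" "d \<in> atlas M" "p \<in> fst d"
  shows "linear (transition c d p)"
proof -
  interpret smooth_maps_between M M id by unfold_locales (use assms smooth_map_id in auto)
  show ?thesis using chart_deriv_linear assms unfolding transition_eq_chart_deriv by simp
qed

lemma mderiv_compose:
  assumes L: "smooth_manifold L" and M: "smooth_manifold M" and N: "smooth_manifold N"
    and \<beta>: "smooth_map L M \<beta>" and f: "smooth_map M N f"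
    and h: "\<And>z. z \<in> pts L \<Longrightarrow> h z = f (\<beta> z)" and p: "p \<in> pts L"
  shows "mderiv L N h p v = mderiv M N f (\<beta> p) (mderiv L M \<beta> p v)"
proof -
  have "\<beta> p \<in> pts M" "f (\<beta> p) \<in> pts N" using smooth_map_in_pts[OF \<beta> p] smooth_map_in_pts[OF f] by auto
  then show ?thesis
    unfolding mderiv_eq_chart_deriv h[OF p]
    using chart_at[OF L p] chart_at[OF M] chart_at[OF N] h[OF p]
    by (intro chart_deriv_compose[OF L M N \<beta> f h]) auto
qed

lemma mderiv_id: "smooth_manifold M \<Longrightarrow> p \<in> pts M \<Longrightarrow> mderiv M M id p v = v"
  by (simp add: mderiv_eq_chart_deriv flip: transition_def) (simp add: transition_self chart_at)

subsection \<open>Self-adjoint maps whose form vanishes on a hyperplane\<close>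

lemma linear_functional_inner:
  fixes l :: "'e::euclidean_space \<Rightarrow> real"
  assumes "linear l"
  shows "(\<Sum>b\<in>Basis. l b *\<^sub>R b) \<bullet> w = l w"
proof -
  have "(\<Sum>b\<in>Basis. l b *\<^sub>R b) \<bullet> w = (\<Sum>b\<in>Basis. l b * (b \<bullet> w))" by (simp add: inner_sum_left)
  also have "\<dots> = l w"
    by (subst (2) linear_apply_basis[OF assms]) (simp add: inner_commute mult.commute)
  finally show ?thesis .
qed

locale inner_form =
  fixes G :: "'e::euclidean_space \<Rightarrow> 'e \<Rightarrow> real"
  assumes bilinear: "bilinear G"
    and sym: "G u v = G v u"
    and pos: "v \<noteq> 0 \<Longrightarrow> G v v > 0"
begin

lemmas G_simps = bilinear_ladd[OF bilinear] bilinear_radd[OF bilinear]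
  bilinear_lmul[OF bilinear] bilinear_rmul[OF bilinear]
  bilinear_lsub[OF bilinear] bilinear_rsub[OF bilinear]
  bilinear_lneg[OF bilinear] bilinear_rneg[OF bilinear]
  bilinear_lzero[OF bilinear] bilinear_rzero[OF bilinear]

lemma G_self_eq_0 [simp]: "G v v = 0 \<longleftrightarrow> v = 0"
  using pos[of v] bilinear_lzero[OF bilinear] by force

lemma G_eqI: "(\<And>w. G u w = G v w) \<Longrightarrow> u = v"
  using G_self_eq_0[of "u - v"] by (simp add: G_simps)

lemma linear_right: "linear (G u)"
  using bilinear by (simp add: bilinear_def)

text \<open>Riesz representation for \<open>G\<close>: the Gram map \<open>T\<close> is injective
  because \<open>G\<close> is definite, hence surjective in finite dimension.\<close>

lemma represent:
  assumes "linear l"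
  shows "\<exists>x. \<forall>w. G x w = l w"
proof -
  define T where "T x = (\<Sum>b\<in>Basis. G x b *\<^sub>R b)" for x
  have T: "T x \<bullet> w = G x w" for x w
    unfolding T_def by (rule linear_functional_inner[OF linear_right])
  have "linear T"
    by (rule linearI) (simp_all add: T_def G_simps algebra_simps sum.distrib scaleR_sum_right)
  moreover have "inj T"
  proof (rule injI)
    fix x y assume xy: "T x = T y"
    show "x = y" by (rule G_eqI) (simp add: T[symmetric] xy)
  qed
  ultimately have "surj T" by (rule linear_injective_imp_surjective) simp
  then obtain x where "(\<Sum>b\<in>Basis. l b *\<^sub>R b) = T x" by (rule surjE)
  then have "G x w = l w" for w
    using linear_functional_inner[OF assms, of w] T[of x w] by metis
  then show ?thesis by blast
qed

lemma dim_orthogonal: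
  assumes "\<nu> \<noteq> 0"
  shows "dim {x. G \<nu> x = 0} = DIM('e) - 1"
proof -
  define a where "a = (\<Sum>b\<in>Basis. G \<nu> b *\<^sub>R b)"
  have a: "a \<bullet> w = G \<nu> w" for w
    unfolding a_def by (rule linear_functional_inner[OF linear_right])
  have "a \<noteq> 0" using a[of \<nu>] assms by auto
  from dim_hyperplane[OF this] show ?thesis by (simp add: a)
qed

lemma hyperplane_eq_orthogonal:
  assumes "subspace R" "dim R = DIM('e) - 1" "\<nu> \<noteq> 0" "\<And>x. x \<in> R \<Longrightarrow> G \<nu> x = 0"
  shows "R = {x. G \<nu> x = 0}"
proof (rule subspace_dim_equal[OF assms(1)])
  show "subspace {x. G \<nu> x = 0}" by (auto simp: subspace_def G_simps)
qed (use assms dim_orthogonal in auto)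

text \<open>A Euclidean normal \<open>a\<close> becomes a \<open>G\<close>-normal by representing
  the functional \<open>\<lambda>w. a \<bullet> w\<close> through \<open>G\<close> and normalizing;
  a dimension count upgrades the inclusion to equality.\<close>

lemma hyperplane_unit_normal:
  assumes "subspace H" "dim H = DIM('e) - 1"
  shows "\<exists>\<nu>. G \<nu> \<nu> = 1 \<and> H = {x. G \<nu> x = 0}"
proof -
  have "dim H < DIM('e)" using assms(2) by simp
  then obtain a where a: "a \<noteq> 0" "\<And>y. y \<in> span H \<Longrightarrow> orthogonal a y"
    using orthogonal_to_subspace_exists by blast
  have "linear (\<lambda>w. a \<bullet> w)" by (simp add: bounded_linear.linear bounded_linear_inner_right)
  then obtain x where x: "\<And>w. G x w = a \<bullet> w" using represent by blast
  have nz: "G x x > 0" using x[of a] a(1) pos[of x] by (cases "x = 0") (auto simp: G_simps)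
  define \<nu> where "\<nu> = (1 / sqrt (G x x)) *\<^sub>R x"
  have nu: "G \<nu> w = (a \<bullet> w) / sqrt (G x x)" for w
    by (simp add: \<nu>_def G_simps x)
  have "x \<noteq> 0" using nz by (auto simp: G_simps)
  then have "G \<nu> \<nu> = 1" using nz by (simp add: \<nu>_def G_simps)
  moreover from this have "\<nu> \<noteq> 0" by (auto simp: G_simps)
  moreover have "G \<nu> y = 0" if "y \<in> H" for y
    using a(2)[of y] that by (simp add: nu orthogonal_def span_base)
  ultimately show ?thesis using hyperplane_eq_orthogonal[OF assms, of \<nu>] by blast
qed

end

section \<open>Symmetric functions of eigenvalues and Newton transformations\<close>

text \<open>An index set that meets the eigenvalue 0 contributes a zero product, so the kernel of
  \<open>A\<close> drops out, and each simple nonzero eigenvalue \<open>k\<close> survives as the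
  single index \<open>(k, 0)\<close>.\<close>

lemma sym_fun_nonzero_eigenvalues:
  fixes A :: "'e::euclidean_space \<Rightarrow> 'e"
  assumes R: "finite R" "0 \<notin> R"
    and eig: "\<And>k. k \<noteq> 0 \<Longrightarrow> dim {v. A v = k *\<^sub>R v} = (if k \<in> R then 1 else 0)"
  shows "sym_fun r A = (\<Sum>J | J \<subseteq> R \<and> card J = r. \<Prod>J)"
proof -
  define NZ where "NZ = (\<lambda>k. (k, 0::nat)) ` R"
  have sub: "NZ \<subseteq> eigen_index A"
  proof -
    have "dim {v. A v = k *\<^sub>R v} = 1" if "k \<in> R" for k
      using eig[of k] that R(2) by (cases "k = 0") auto
    then show ?thesis by (auto simp: NZ_def eigen_index_def)
  qed
  have nz: "j \<in> NZ" if "j \<in> eigen_index A" "fst j \<noteq> 0" for j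
    using that eig[of "fst j"] by (cases j) (auto simp: NZ_def eigen_index_def split: if_splits)
  have "eigen_index A \<subseteq> NZ \<union> {0} \<times> {..<DIM('e)}"
  proof
    fix j assume j: "j \<in> eigen_index A"
    then show "j \<in> NZ \<union> {0} \<times> {..<DIM('e)}"
      using nz[OF j] dim_subset_UNIV[of "{v. A v = fst j *\<^sub>R v}"]
      by (cases j) (fastforce simp: eigen_index_def)
  qed
  from finite_subset[OF this] have fin: "finite (eigen_index A)" using R(1) by (simp add: NZ_def)
  have inj: "inj_on (\<lambda>k. (k, 0::nat)) X" for X :: "real set" by (auto simp: inj_on_def)
  have "sym_fun r A = (\<Sum>J | J \<subseteq> NZ \<and> card J = r. \<Prod>(k, i)\<in>J. k)"
    unfolding sym_fun_def
  proof (rule sum.mono_neutral_right)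
    show "finite {J. J \<subseteq> eigen_index A \<and> card J = r}" using fin by simp
    show "{J. J \<subseteq> NZ \<and> card J = r} \<subseteq> {J. J \<subseteq> eigen_index A \<and> card J = r}" using sub by auto
    show "\<forall>J\<in>{J. J \<subseteq> eigen_index A \<and> card J = r} - {J. J \<subseteq> NZ \<and> card J = r}.
        (\<Prod>(k, i)\<in>J. k) = 0"
    proof
      fix J assume "J \<in> {J. J \<subseteq> eigen_index A \<and> card J = r} - {J. J \<subseteq> NZ \<and> card J = r}"
      then have J: "J \<subseteq> eigen_index A" "\<not> J \<subseteq> NZ" by auto
      then obtain j where "j \<in> J" "fst j = 0" using nz by blast
      then show "(\<Prod>(k, i)\<in>J. k) = 0"
        using finite_subset[OF J(1) fin] by (intro prod_zero) (auto simp: case_prod_unfold)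
    qed
  qed
  also have "\<dots> = (\<Sum>J | J \<subseteq> R \<and> card J = r. \<Prod>J)"
  proof (rule sum.reindex_bij_betw[symmetric, THEN trans, OF _ sum.cong])
    show "bij_betw ((`) (\<lambda>k. (k, 0::nat))) {J. J \<subseteq> R \<and> card J = r} {J. J \<subseteq> NZ \<and> card J = r}"
    proof (rule bij_betw_imageI)
      show "inj_on ((`) (\<lambda>k. (k, 0::nat))) {J. J \<subseteq> R \<and> card J = r}"
        by (intro inj_onI) (simp add: inj_image_eq_iff inj)
      show "(`) (\<lambda>k. (k, 0::nat)) ` {J. J \<subseteq> R \<and> card J = r} = {J. J \<subseteq> NZ \<and> card J = r}"
        unfolding NZ_def by (auto simp: subset_image_iff card_image inj image_iff)
    qed
    show "(\<Prod>(k, i)\<in>(\<lambda>k. (k, 0::nat)) ` J. k) = \<Prod>J" for J :: "real set"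
      by (simp add: prod.reindex inj)
  qed simp
  finally show ?thesis .
qed

text \<open>The discriminant \<open>c^2 + 4 * d\<close> is nonnegative, so both roots are real; they
  are given through their sum and product, the only data used later.\<close>

lemma real_quadratic_roots:
  fixes c d :: real
  assumes "d \<ge> 0"
  shows "\<exists>k1 k2. k1 + k2 = c \<and> k1 * k2 = - d \<and> (\<forall>k. k^2 - c * k - d = 0 \<longleftrightarrow> k = k1 \<or> k = k2)"
proof -
  define s where "s = sqrt (c^2 + 4 * d)"
  have s: "s * s = c * c + 4 * d" using assms by (simp add: s_def power2_eq_square)
  have prod: "((c + s) / 2) * ((c - s) / 2) = - d" using s by (simp add: field_simps)
  have "k^2 - c * k - d = (k - (c + s) / 2) * (k - (c - s) / 2)" for k
  proof -
    have "(k - (c + s) / 2) * (k - (c - s) / 2) = k^2 - c * k + ((c + s) / 2) * ((c - s) / 2)"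
      by (simp add: field_simps power2_eq_square)
    then show ?thesis using prod by simp
  qed
  then have "k^2 - c * k - d = 0 \<longleftrightarrow> k = (c + s) / 2 \<or> k = (c - s) / 2" for k
    by (simp only: mult_eq_0_iff right_minus_eq)
  moreover have "(c + s) / 2 + (c - s) / 2 = c" by (simp add: field_simps)
  ultimately show ?thesis using prod by blast
qed

context inner_form
begin

text \<open>In an orthonormal basis adapted to the hyperplane, \<open>A\<close> is zero except for its last row
  and column \<open>(b, c)\<close>, so its nonzero eigenvalues are the nonzero roots of
  \<open>k\<^sup>2 - c k - \<bar>b\<bar>\<^sup>2\<close>, all of them simple.\<close>

lemma selfadjoint_vanishing_on_hyperplane:
  assumes lin: "linear A" and self: "\<And>u v. G (A u) v = G u (A v)"
    and \<nu>: "G \<nu> \<nu> = 1" and H: "\<And>e f. G \<nu> e = 0 \<Longrightarrow> G \<nu> f = 0 \<Longrightarrow> G (A e) f = 0"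
  shows "sym_fun 2 A \<le> 0" and "\<And>r. r \<ge> 3 \<Longrightarrow> sym_fun r A = 0"
    and "\<And>r. r \<ge> 1 \<Longrightarrow> G (newton r A \<nu>) \<nu> = 0"
proof -
  define c where "c = G (A \<nu>) \<nu>"
  define b where "b = A \<nu> - c *\<^sub>R \<nu>"
  define d where "d = G b b"
  have \<nu>b: "G \<nu> b = 0" by (simp add: b_def c_def G_simps \<nu> sym[of \<nu> "A \<nu>"])
  have A\<nu>: "A \<nu> = b + c *\<^sub>R \<nu>" by (simp add: b_def)
  have \<nu>0: "\<nu> \<noteq> 0" using \<nu> by (auto simp: G_simps)
  \<comment> \<open>The remainder \<open>w\<close> is orthogonal to \<open>\<nu>\<close>, hence by
    \<open>H\<close> to \<open>A e\<close>, hence to itself. Self-adjointness supplies the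
    coefficient of \<open>\<nu>\<close>.\<close>
  have Ae: "A e = G e b *\<^sub>R \<nu>" if e: "G \<nu> e = 0" for e
  proof -
    have *: "G (A e) \<nu> = G e b" using self[of e \<nu>] e by (simp add: A\<nu> G_simps sym[of e \<nu>])
    define w where "w = A e - G e b *\<^sub>R \<nu>"
    have "G \<nu> w = 0" by (simp add: w_def G_simps \<nu> sym[of \<nu> "A e"] *)
    with H[OF e this] have "G w w = 0" by (subst (1) w_def) (simp add: G_simps)
    then show ?thesis by (simp add: w_def)
  qed
  have A: "A v = (G v b + c * G \<nu> v) *\<^sub>R \<nu> + G \<nu> v *\<^sub>R b" for v
  proof -
    define e where "e = v - G \<nu> v *\<^sub>R \<nu>"
    have e: "G \<nu> e = 0" by (simp add: e_def G_simps \<nu>)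
    have "v = e + G \<nu> v *\<^sub>R \<nu>" by (simp add: e_def)
    then have "A v = A e + G \<nu> v *\<^sub>R A \<nu>" by (metis lin linear_add linear_scale)
    also have "\<dots> = G e b *\<^sub>R \<nu> + G \<nu> v *\<^sub>R (b + c *\<^sub>R \<nu>)" using Ae[OF e] A\<nu> by simp
    also have "G e b = G v b" by (simp add: e_def G_simps \<nu>b)
    finally show ?thesis by (simp add: algebra_simps)
  qed
  have d: "d \<ge> 0" using pos[of b] by (cases "b = 0") (auto simp: d_def G_simps)
  obtain k1 k2 where k: "k1 + k2 = c" "k1 * k2 = - d"
    "\<And>k. k^2 - c * k - d = 0 \<longleftrightarrow> k = k1 \<or> k = k2"
    using real_quadratic_roots[OF d] by metis
  define R where "R = {k1, k2} - {0}"
  \<comment> \<open>Pairing the eigenvalue equation with \<open>\<nu>\<close> and substituting back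
    makes \<open>v\<close> a multiple of \<open>b + k *\<^sub>R \<nu>\<close>; pairing with
    \<open>b\<close> then forces \<open>k\<close> to be a root unless \<open>v = 0\<close>.\<close>
  have eig: "{v. A v = k *\<^sub>R v} = (if k \<in> R then span {b + k *\<^sub>R \<nu>} else {0})" if "k \<noteq> 0" for k
  proof -
    have fwd: "v = (G \<nu> v / k) *\<^sub>R (b + k *\<^sub>R \<nu>) \<and> (k \<in> R \<or> v = 0)" if v: "A v = k *\<^sub>R v" for v
    proof -
      have 1: "G v b + c * G \<nu> v = k * G \<nu> v"
        using arg_cong[OF v, of "G \<nu>"] by (simp add: A G_simps \<nu> \<nu>b)
      have "k *\<^sub>R v = (k * G \<nu> v) *\<^sub>R \<nu> + G \<nu> v *\<^sub>R b" using v A[of v] 1 by simp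
      then have "(1 / k) *\<^sub>R (k *\<^sub>R v) = (1 / k) *\<^sub>R ((k * G \<nu> v) *\<^sub>R \<nu> + G \<nu> v *\<^sub>R b)" by simp
      then have 2: "v = (G \<nu> v / k) *\<^sub>R (b + k *\<^sub>R \<nu>)"
        using \<open>k \<noteq> 0\<close> by (simp add: algebra_simps)
      have "G v b = (G \<nu> v / k) * d"
        using arg_cong[OF 2, of "\<lambda>v. G v b"] by (simp add: G_simps \<nu>b d_def)
      with 1 have "G \<nu> v * (k^2 - c * k - d) = 0"
        using \<open>k \<noteq> 0\<close> by (simp add: field_simps power2_eq_square)
      then have "G \<nu> v = 0 \<or> k \<in> R" using k(3) \<open>k \<noteq> 0\<close> by (auto simp: R_def)
      then show ?thesis using 2 by auto
    qed
    have bwd: "A (t *\<^sub>R (b + k *\<^sub>R \<nu>)) = k *\<^sub>R (t *\<^sub>R (b + k *\<^sub>R \<nu>))" if "k \<in> R" for t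
    proof -
      have "k^2 - c * k - d = 0" using k(3) that by (auto simp: R_def)
      then have "d + c * k = k * k" by (simp add: power2_eq_square)
      then have "A (b + k *\<^sub>R \<nu>) = k *\<^sub>R (b + k *\<^sub>R \<nu>)"
        by (simp add: A G_simps \<nu> \<nu>b d_def[symmetric] algebra_simps)
      then show ?thesis using linear_scale[OF lin] by simp
    qed
    show ?thesis
      using fwd bwd linear_0[OF lin] by (auto simp: span_singleton)
  qed
  have bk: "b + k *\<^sub>R \<nu> \<noteq> 0" if "k \<noteq> 0" for k
  proof
    assume "b + k *\<^sub>R \<nu> = 0"
    then have "G \<nu> (b + k *\<^sub>R \<nu>) = 0" by (simp add: G_simps)
    then show False using that by (simp add: G_simps \<nu> \<nu>b)
  qed
  have sf: "sym_fun r A = (\<Sum>J | J \<subseteq> R \<and> card J = r. \<Prod>J)" for r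
    by (rule sym_fun_nonzero_eigenvalues) (use eig bk in \<open>auto simp: R_def\<close>)
  have S3: "sym_fun r A = 0" if "r \<ge> 3" for r
  proof -
    have card: "card J \<le> 2" if "J \<subseteq> R" for J
    proof -
      have "card J \<le> card {k1, k2}" using that by (intro card_mono) (auto simp: R_def)
      also have "\<dots> \<le> 2" by (simp add: card_insert_if)
      finally show ?thesis .
    qed
    have "card J \<noteq> r" if "J \<subseteq> R" for J using card[OF that] \<open>r \<ge> 3\<close> by linarith
    then have empty: "{J. J \<subseteq> R \<and> card J = r} = {}" by blast
    show ?thesis unfolding sf empty by simp
  qed
  have S12: "sym_fun 1 A = c \<and> sym_fun 2 A = - d"
  proof -
    have one: "{J. J \<subseteq> R \<and> card J = 1} = (\<lambda>k. {k}) ` R" by (auto simp: card_1_singleton_iff)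
    have S1: "sym_fun 1 A = \<Sum>R" unfolding sf one by (subst sum.reindex) (auto simp: inj_on_def)
    show ?thesis
    \<comment> \<open>For \<open>d = 0\<close> one root vanishes, so \<open>R\<close> has at most
      one element and no pairs; it is empty when also \<open>c = 0\<close>. Otherwise the product
      \<open>- d\<close> of the roots is negative, so they are nonzero and distinct and
      \<open>R\<close> is the only pair.\<close>
    proof (cases "d = 0")
      case True
      then have *: "k1 = 0 \<or> k2 = 0" using k(2) by auto
      then have "R \<subseteq> {c}" using k(1) by (auto simp: R_def)
      then have two: "card R \<le> 1" using card_mono[of "{c}" R] by simp
      have "finite R" by (simp add: R_def)
      then have "card J \<noteq> 2" if "J \<subseteq> R" for J using card_mono[of R J] that two by linarith
      then have empty: "{J. J \<subseteq> R \<and> card J = 2} = {}" by blast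
      have "sym_fun 2 A = 0" unfolding sf empty by simp
      moreover have "\<Sum>R = c" using * k(1)
        by (cases "k1 = 0"; cases "k2 = 0") (auto simp: R_def insert_Diff_if)
      ultimately show ?thesis using S1 True by simp
    next
      case False
      then have **: "k1 \<noteq> 0" "k2 \<noteq> 0" using k(2) by auto
      moreover have "k1 \<noteq> k2"
      proof
        assume "k1 = k2"
        with k(2) have "k2 * k2 = - d" by simp
        with zero_le_square[of k2] d False show False by linarith
      qed
      ultimately have R: "R = {k1, k2}" "card R = 2" by (auto simp: R_def)
      then have "J = R" if "J \<subseteq> R" "card J = 2" for J
        using that card_subset_eq[of R J] by simp
      then have two: "{J. J \<subseteq> R \<and> card J = 2} = {R}" using R(2) by blast
      have "sym_fun 2 A = k1 * k2" unfolding sf two using R \<open>k1 \<noteq> k2\<close> by simp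
      then show ?thesis using S1 R \<open>k1 \<noteq> k2\<close> k by simp
    qed
  qed
  show "sym_fun 2 A \<le> 0" using S12 d by simp
  show "\<And>r. r \<ge> 3 \<Longrightarrow> sym_fun r A = 0" by fact
  \<comment> \<open>The Newton recursion at \<open>\<nu>\<close>: the first transformation gives
    \<open>- b\<close>, orthogonal to \<open>\<nu>\<close>; in the second, \<open>- d\<close> from
    \<open>sym_fun 2 A\<close> cancels against \<open>A b = d *\<^sub>R \<nu>\<close>; after that
    every term is zero.\<close>
  have N1: "newton (Suc 0) A \<nu> = - b" using S12 by (simp add: A\<nu>)
  have Ab: "A b = d *\<^sub>R \<nu>" by (simp add: Ae[OF \<nu>b] d_def)
  have N2: "newton (Suc (Suc r)) A \<nu> = 0" for r
  proof (induction r)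
    case 0
    have "sym_fun (Suc (Suc 0)) A = - d" using S12 by (simp add: numeral_2_eq_2)
    moreover have "A (- b) = - (d *\<^sub>R \<nu>)" using linear_neg[OF lin, of b] Ab by simp
    ultimately show ?case using N1 by simp
  next
    case (Suc r)
    have "sym_fun (Suc (Suc (Suc r))) A = 0" by (rule S3) simp
    then show ?case unfolding newton.simps(2)[of "Suc (Suc r)"] Suc.IH by (simp add: linear_0[OF lin])
  qed
  show "G (newton r A \<nu>) \<nu> = 0" if "r \<ge> 1" for r
  proof (cases "r = 1")
    case True
    then show ?thesis using N1 \<nu>b by (simp add: G_simps sym[of b])
  next
    case False
    with that have "r = Suc (Suc (r - 2))" by simp
    with N2[of "r - 2"] show ?thesis by (simp only: bilinear_lzero[OF bilinear])
  qed
qed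

end

subsection \<open>The Levi-Civita connection\<close>

context inner_form
begin

text \<open>\<open>B u v w\<close> plays the role of the derivative in direction \<open>u\<close> of the metric coefficient
  of \<open>v\<close> and \<open>w\<close>; \<open>K\<close> is the right-hand side of the Koszul formula.\<close>

lemma koszul:
  assumes lin: "\<And>v w. linear (\<lambda>u. B u v w)" and bil: "\<And>u. bilinear (B u)"
    and symB: "\<And>u v w. B u v w = B u w v"
  shows "\<exists>!\<Gamma>. bilinear \<Gamma> \<and> (\<forall>u v. \<Gamma> u v = \<Gamma> v u) \<and>
    (\<forall>u v w. B u v w = G (\<Gamma> u v) w + G v (\<Gamma> u w))"
proof -
  define K where "K u v w = (B u v w + B v w u - B w u v) / 2" for u v w
  note B_simps = linear_add[OF lin] linear_scale[OF lin] bilinear_ladd[OF bil]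
    bilinear_radd[OF bil] bilinear_lmul[OF bil] bilinear_rmul[OF bil]
  have "linear (K u v)" for u v
    by (rule linearI) (simp_all add: K_def B_simps field_simps)
  then have "\<exists>x. \<forall>w. G x w = K u v w" for u v by (rule represent)
  then obtain \<Gamma> where \<Gamma>: "\<And>u v w. G (\<Gamma> u v) w = K u v w" by metis
  have sym\<Gamma>: "\<Gamma> u v = \<Gamma> v u" for u v
  proof (rule G_eqI)
    show "G (\<Gamma> u v) w = G (\<Gamma> v u) w" for w
      using symB[of u v w] symB[of v w u] symB[of w u v] by (simp add: \<Gamma> K_def)
  qed
  have lin1: "linear (\<lambda>u. \<Gamma> u v)" for v
    by (rule linearI; rule G_eqI) (simp_all add: \<Gamma> G_simps K_def B_simps field_simps)
  have "bilinear \<Gamma>"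
    unfolding bilinear_def using lin1 by (simp add: sym\<Gamma>)
  moreover have "B u v w = G (\<Gamma> u v) w + G v (\<Gamma> u w)" for u v w
    using symB[of u v w] symB[of v w u] symB[of w u v]
    by (simp add: sym[of v] \<Gamma> K_def field_simps)
  \<comment> \<open>Adding the compatibility identities for \<open>u v w\<close> and
    \<open>v w u\<close> and subtracting the one for \<open>w u v\<close> leaves
    \<open>2 * G (\<Gamma>' u v) w\<close>, so any candidate satisfies the Koszul formula.\<close>
  moreover have "\<Gamma>' = \<Gamma>"
    if s: "\<And>u v. \<Gamma>' u v = \<Gamma>' v u" and c: "\<And>u v w. B u v w = G (\<Gamma>' u v) w + G v (\<Gamma>' u w)" for \<Gamma>'
  proof (intro ext G_eqI)
    fix u v w
    have "G (\<Gamma>' u v) w = K u v w"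
      unfolding K_def
      using c[of u v w] c[of v w u] c[of w u v] sym[of v "\<Gamma>' u w"] sym[of w "\<Gamma>' v u"]
        sym[of u "\<Gamma>' w v"] s[of w u] s[of v u] s[of w v] by simp
    then show "G (\<Gamma>' u v) w = G (\<Gamma> u v) w" by (simp add: \<Gamma>)
  qed
  ultimately show ?thesis using sym\<Gamma> by (intro ex1I[of _ \<Gamma>]) blast+
qed

end

lemma bilinear_apply_basis:
  fixes b :: "'e::euclidean_space \<Rightarrow> 'e \<Rightarrow> real"
  assumes "bilinear b"
  shows "b u v = (\<Sum>i\<in>Basis. \<Sum>j\<in>Basis. (u \<bullet> i) * (v \<bullet> j) * b i j)"
proof -
  have l: "linear (\<lambda>x. b x y)" "linear (b x)" for x y using assms by (auto simp: bilinear_def)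
  have "b u v = (\<Sum>i\<in>Basis. (u \<bullet> i) * b i v)" using linear_apply_basis[OF l(1), of u v] by simp
  also have "\<dots> = (\<Sum>i\<in>Basis. \<Sum>j\<in>Basis. (u \<bullet> i) * (v \<bullet> j) * b i j)"
    using linear_apply_basis[OF l(2), of _ v] by (simp add: sum_distrib_left mult.assoc)
  finally show ?thesis .
qed

section \<open>Metric coefficients in charts, their derivatives and the Leibniz rule\<close>

locale riemannian =
  fixes M :: "('a, 'e::euclidean_space) mfd" and g :: "('a, 'e) metric"
  assumes smooth: "smooth_manifold M" and boundaryless: "mboundary M = {}"
    and metric: "riemannian_metric M g"
begin

abbreviation m :: "('a, 'e) chart \<Rightarrow> 'e \<Rightarrow> 'e \<Rightarrow> 'e \<Rightarrow> real" where
  "m \<equiv> metric_in_chart M g"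

lemma inner_form: "p \<in> pts M \<Longrightarrow> inner_form (g p)"
  using metric unfolding riemannian_metric_def inner_form_def by simp

lemma metric_in_chart:
  "d \<in> atlas M \<Longrightarrow> q \<in> fst d \<Longrightarrow> m d (snd d q) u v
     = g q (transition d (chart_at M q) q u) (transition d (chart_at M q) q v)"
  by (simp add: metric_in_chart_def Let_def chart_inv_chart[OF smooth])

text \<open>Transport from the preferred chart to \<open>d\<close> and back is the identity. This
  lets a scalar product computed in one fixed chart be recognized as a constant function near a
  point.\<close>

lemma metric_transition:
  assumes d: "d \<in> atlas M" "q \<in> fst d"
  shows "m d (snd d q) (transition (chart_at M q) d q u) (transition (chart_at M q) d q v) = g q u v"
proof -
  have "q \<in> pts M" using d chart_subset_pts[OF smooth] by blast
  then show ?thesis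
    using transition_transition[OF smooth chart_at[OF smooth] d chart_at[OF smooth]]
      transition_self[OF smooth chart_at[OF smooth]]
    by (simp add: metric_in_chart[OF d])
qed

lemma metric_preferred:
  assumes "p \<in> pts M"
  shows "m (chart_at M p) (snd (chart_at M p) p) u v = g p u v"
  using metric_in_chart[OF chart_at[OF smooth assms]]
  by (simp add: transition_self[OF smooth chart_at[OF smooth assms]])

lemma metric_in_chart_bilinear:
  assumes d: "d \<in> atlas M" "x \<in> chart_image d"
  shows "bilinear (m d x)" and "m d x u v = m d x v u"
proof -
  obtain q where q: "q \<in> fst d" "x = snd d q" using d by (auto simp: chart_image_def)
  have qM: "q \<in> pts M" using d q chart_subset_pts[OF smooth] by blast
  interpret G: inner_form "g q" by (rule inner_form[OF qM])
  have T: "linear (transition d (chart_at M q) q)"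
    by (rule transition_linear[OF smooth d(1) q(1) chart_at[OF smooth qM]])
  show "bilinear (m d x)"
    unfolding bilinear_def q(2)
    by (auto intro!: linearI simp: metric_in_chart[OF d(1) q(1)] G.G_simps
        linear_add[OF T] linear_scale[OF T])
  show "m d x u v = m d x v u"
    by (simp add: q(2) metric_in_chart[OF d(1) q(1)] G.sym)
qed

lemma metric_has_derivative:
  assumes d: "d \<in> atlas M" "x \<in> chart_image d"
  shows "((\<lambda>x. m d x u v) has_derivative
     frechet_derivative (\<lambda>x. m d x u v) (at x within chart_image d)) (at x within chart_image d)"
proof (rule smooth_on_frechet_derivatives(1)[OF chart_halfspace_open[OF smooth d(1)]])
  show "smooth_on (\<lambda>x. m d x u v) (chart_image d)"
    using metric d(1) by (simp add: riemannian_metric_def)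
qed (use d in auto)

abbreviation metric_deriv :: "('a, 'e) chart \<Rightarrow> 'e \<Rightarrow> 'e \<Rightarrow> 'e \<Rightarrow> 'e \<Rightarrow> real" where
  "metric_deriv d x u v w \<equiv> frechet_derivative (\<lambda>x. m d x v w) (at x within chart_image d) u"

lemma metric_deriv_eqI:
  assumes d: "d \<in> atlas M" "x \<in> chart_image d"
    and "(f has_derivative f') (at x within chart_image d)"
    and "\<And>y. y \<in> chart_image d \<Longrightarrow> m d y v w = f y"
  shows "metric_deriv d x u v w = f' u"
proof -
  have "((\<lambda>y. m d y v w) has_derivative f') (at x within chart_image d)"
    using assms(4) by (intro has_derivative_transform[OF d(2) _ assms(3)])
  from halfspace_open_frechet_derivative[OF chart_halfspace_open[OF smooth d(1)] d(2) this]
  show ?thesis by simp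
qed

text \<open>Bilinearity and symmetry hold at every point of the chart image and pass to the
  derivative because derivatives within that image are unique.\<close>

lemma metric_deriv_multilinear:
  assumes d: "d \<in> atlas M" "x \<in> chart_image d"
  shows "linear (\<lambda>u. metric_deriv d x u v w)" and "bilinear (metric_deriv d x u)"
    and "metric_deriv d x u v w = metric_deriv d x u w v"
proof -
  note D = metric_has_derivative[OF d]
  note bil = metric_in_chart_bilinear(1)[OF d(1)]
  show "linear (\<lambda>u. metric_deriv d x u v w)" using has_derivative_linear[OF D] .
  show sym: "metric_deriv d x u v w = metric_deriv d x u w v" for v w
    by (rule metric_deriv_eqI[OF d D]) (rule metric_in_chart_bilinear(2)[OF d(1)])
  have "linear (\<lambda>v. metric_deriv d x u v w)" for w
  proof (rule linearI)
    show "metric_deriv d x u (v + v') w = metric_deriv d x u v w + metric_deriv d x u v' w" for v v'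
      by (rule metric_deriv_eqI[OF d has_derivative_add[OF D D]]) (simp add: bilinear_ladd[OF bil])
    show "metric_deriv d x u (r *\<^sub>R v) w = r *\<^sub>R metric_deriv d x u v w" for r v
      by (rule metric_deriv_eqI[OF d has_derivative_scaleR_right[OF D]]) (simp add: bilinear_lmul[OF bil])
  qed
  then show "bilinear (metric_deriv d x u)"
    unfolding bilinear_def using sym by simp
qed

text \<open>Unique existence from \<open>koszul\<close>, with the derivative of the metric
  coefficients as \<open>B\<close>, shows that the definite description in
  \<open>levi_civita_def\<close> denotes.\<close>

lemma levi_civita:
  assumes p: "p \<in> pts M"
  shows "bilinear (levi_civita M g p)" and "levi_civita M g p u v = levi_civita M g p v u"
    and "metric_deriv (chart_at M p) (snd (chart_at M p) p) u v w
         = g p (levi_civita M g p u v) w + g p v (levi_civita M g p u w)"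
proof -
  interpret G: inner_form "g p" by (rule inner_form[OF p])
  let ?d = "chart_at M p"
  have d: "?d \<in> atlas M" "snd ?d p \<in> chart_image ?d"
    by (rule chart_at[OF smooth p], rule chart_in_image[OF chart_at(2)[OF smooth p]])
  have "\<exists>!\<Gamma>. bilinear \<Gamma> \<and> (\<forall>u v. \<Gamma> u v = \<Gamma> v u) \<and>
      (\<forall>u v w. metric_deriv ?d (snd ?d p) u v w = g p (\<Gamma> u v) w + g p v (\<Gamma> u w))"
    by (rule G.koszul[OF metric_deriv_multilinear[OF d]])
  from theI'[OF this] show "bilinear (levi_civita M g p)"
    and "levi_civita M g p u v = levi_civita M g p v u"
    and "metric_deriv (chart_at M p) (snd (chart_at M p) p) u v w
         = g p (levi_civita M g p u v) w + g p v (levi_civita M g p u w)"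
    unfolding levi_civita_def Let_def by blast+
qed

text \<open>Metric compatibility for fields along a map \<open>K\<close>, given by components in the
  chart at \<open>p\<close>. Expansion in a basis reduces it to the product rule; the derivative of
  the metric coefficients then splits into the two Christoffel terms.\<close>

lemma leibniz:
  fixes K X Y :: "'z::euclidean_space \<Rightarrow> 'e"
  assumes p: "p \<in> pts M" and x: "x \<in> S" and Kx: "K x = snd (chart_at M p) p"
    and K: "(K has_derivative K') (at x within S)"
    and X: "(X has_derivative X') (at x within S)"
    and Y: "(Y has_derivative Y') (at x within S)"
  shows "((\<lambda>y. m (chart_at M p) (K y) (X y) (Y y)) has_derivative
      (\<lambda>v. g p (X' v + levi_civita M g p (K' v) (X x)) (Y x) +
           g p (X x) (Y' v + levi_civita M g p (K' v) (Y x)))) (at x within S)"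
proof -
  interpret G: inner_form "g p" by (rule inner_form[OF p])
  define d where "d = chart_at M p"
  define B where "B = metric_deriv d (K x)"
  have d: "d \<in> atlas M" "K x \<in> chart_image d"
    unfolding d_def Kx by (rule chart_at[OF smooth p], rule chart_in_image[OF chart_at(2)[OF smooth p]])
  \<comment> \<open>The absence of boundary in the ambient manifold makes the metric coefficients
    differentiable on a full neighbourhood, so they can be composed with \<open>K\<close> whatever
    the set \<open>S\<close> is.\<close>
  have op: "open (chart_image d)" by (rule boundaryless_chart_open[OF boundaryless smooth d(1)])
  have D: "((\<lambda>y. m d (K y) i j) has_derivative (\<lambda>v. B (K' v) i j)) (at x within S)" for i j
  proof (rule has_derivative_compose[OF K])
    show "((\<lambda>y. m d y i j) has_derivative (\<lambda>u. B u i j)) (at (K x))"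
      using metric_has_derivative[OF d] at_within_open[OF d(2) op] by (simp add: B_def)
  qed
  have Xi: "((\<lambda>y. X y \<bullet> i) has_derivative (\<lambda>v. X' v \<bullet> i)) (at x within S)" for i
    by (rule has_derivative_inner_left[OF X])
  have Yi: "((\<lambda>y. Y y \<bullet> i) has_derivative (\<lambda>v. Y' v \<bullet> i)) (at x within S)" for i
    by (rule has_derivative_inner_left[OF Y])
  have bil: "bilinear (m d (K x))" "bilinear (B u)" for u
    using metric_in_chart_bilinear(1)[OF d] metric_deriv_multilinear(2)[OF d] by (auto simp: B_def)
  have mp: "m d (K x) u v = g p u v" for u v
    unfolding Kx d_def by (rule metric_preferred[OF p])
  have "((\<lambda>y. \<Sum>i\<in>Basis. \<Sum>j\<in>Basis. (X y \<bullet> i) * (Y y \<bullet> j) * m d (K y) i j) has_derivative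
      (\<lambda>v. \<Sum>i\<in>Basis. \<Sum>j\<in>Basis. (X x \<bullet> i) * (Y x \<bullet> j) * B (K' v) i j
         + ((X x \<bullet> i) * (Y' v \<bullet> j) + (X' v \<bullet> i) * (Y x \<bullet> j)) * m d (K x) i j)) (at x within S)"
    by (intro has_derivative_sum has_derivative_mult Xi Yi D)
  also have "(\<lambda>v. \<Sum>i\<in>Basis. \<Sum>j\<in>Basis. (X x \<bullet> i) * (Y x \<bullet> j) * B (K' v) i j
         + ((X x \<bullet> i) * (Y' v \<bullet> j) + (X' v \<bullet> i) * (Y x \<bullet> j)) * m d (K x) i j)
      = (\<lambda>v. B (K' v) (X x) (Y x) + (m d (K x) (X x) (Y' v) + m d (K x) (X' v) (Y x)))"
    unfolding bilinear_apply_basis[OF bil(1), of "X x" "Y' _"]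
      bilinear_apply_basis[OF bil(1), of "X' _" "Y x"] bilinear_apply_basis[OF bil(2), of _ "X x" "Y x"]
    by (simp add: sum.distrib distrib_right)
  also have "\<dots> = (\<lambda>v. g p (X' v + levi_civita M g p (K' v) (X x)) (Y x) +
           g p (X x) (Y' v + levi_civita M g p (K' v) (Y x)))"
    unfolding mp unfolding B_def Kx d_def levi_civita(3)[OF p] by (simp add: G.G_simps algebra_simps)
  finally have deriv: "((\<lambda>y. \<Sum>i\<in>Basis. \<Sum>j\<in>Basis. (X y \<bullet> i) * (Y y \<bullet> j) * m d (K y) i j) has_derivative
      (\<lambda>v. g p (X' v + levi_civita M g p (K' v) (X x)) (Y x) +
           g p (X x) (Y' v + levi_civita M g p (K' v) (Y x)))) (at x within S)" .
  have "(K \<longlongrightarrow> K x) (at x within S)"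
    using has_derivative_continuous[OF K] by (simp add: continuous_within)
  then have "\<forall>\<^sub>F y in at x within S. K y \<in> chart_image d"
    using op d(2) by (rule topological_tendstoD)
  then have ev: "\<forall>\<^sub>F y in at x within S.
      (\<Sum>i\<in>Basis. \<Sum>j\<in>Basis. (X y \<bullet> i) * (Y y \<bullet> j) * m d (K y) i j) = m d (K y) (X y) (Y y)"
    by eventually_elim (rule bilinear_apply_basis[OF metric_in_chart_bilinear(1)[OF d(1)], symmetric])
  show ?thesis
    unfolding d_def[symmetric]
    by (rule has_derivative_transform_eventually[OF deriv ev bilinear_apply_basis[OF bil(1), symmetric] x])
qed

end

subsection \<open>Hypersurfaces\<close>

text \<open>Here \<open>M\<close> is the ambient manifold and \<open>X\<close> the hypersurface,
  possibly with boundary. The locale is used for the given hypersurface with \<open>\<psi>\<close>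
  and for \<open>P\<close> with the inclusion \<open>id\<close>.\<close>

locale immersed_hypersurface = riemannian M g
  for M :: "('a, 'e::euclidean_space) mfd" and g :: "('a, 'e) metric" +
  fixes X :: "('m, 'x::euclidean_space) mfd" and f :: "'m \<Rightarrow> 'a" and N :: "'m \<Rightarrow> 'e"
  assumes smooth_X: "smooth_manifold X" and immersion: "immersion X M f"
    and normal: "unit_normal X M g f N" and dim: "DIM('e) = DIM('x) + 1"
begin

sublocale smooth_maps_between X M f
  by unfold_locales (use smooth_X smooth immersion in \<open>auto simp: immersion_def\<close>)

lemma mderiv_inj: "p \<in> pts X \<Longrightarrow> inj (mderiv X M f p)"
  using immersion by (simp add: immersion_def)

lemma normal_unit: "p \<in> pts X \<Longrightarrow> g (f p) (N p) (N p) = 1"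
  and normal_orthogonal: "p \<in> pts X \<Longrightarrow> g (f p) (N p) (mderiv X M f p v) = 0"
  using normal by (simp_all add: unit_normal_def)

lemma range_mderiv:
  assumes p: "p \<in> pts X"
  shows "range (mderiv X M f p) = {x. g (f p) (N p) x = 0}"
proof -
  interpret G: inner_form "g (f p)" by (rule inner_form[OF in_pts[OF p]])
  show ?thesis
  proof (rule G.hyperplane_eq_orthogonal)
    show "subspace (range (mderiv X M f p))"
      by (rule linear_subspace_image[OF mderiv_linear[OF p] subspace_UNIV])
    show "dim (range (mderiv X M f p)) = DIM('e) - 1"
      using dim_image_eq[OF mderiv_linear[OF p], of UNIV] mderiv_inj[OF p] dim by simp
    show "N p \<noteq> 0" using normal_unit[OF p] by (auto simp: G.G_simps)
  qed (use normal_orthogonal[OF p] in auto)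
qed

abbreviation normal_rep :: "('m, 'x) chart \<Rightarrow> ('a, 'e) chart \<Rightarrow> 'x \<Rightarrow> 'e" where
  "normal_rep c d \<equiv> \<lambda>x. let q = chart_inv c x in transition (chart_at M (f q)) d (f q) (N q)"

lemma normal_has_derivative:
  assumes c: "c \<in> atlas X" "p \<in> fst c" and d: "d \<in> atlas M" "f p \<in> fst d"
  shows "(normal_rep c d has_derivative
     frechet_derivative (normal_rep c d) (at (snd c p) within chart_image c))
     (at (snd c p) within chart_image c)"
proof (rule smooth_on_frechet_derivatives(1)[OF chart_halfspace_open[OF smooth_X c(1)]
      domain_openin[OF c(1) d(1)]])
  show "smooth_on (normal_rep c d) (chart_domain c f d)"
    using normal c(1) d(1) by (simp add: unit_normal_def smooth_along_def)
qed (use c d in auto)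

text \<open>Differentiating the constant function \<open>g (f p) (N p) (N p) = 1\<close> shows that
  the derivative of \<open>N\<close> is orthogonal to \<open>N\<close>. Hence the equation defining
  the shape operator is solvable.\<close>

lemma cov_deriv_tangent:
  assumes p: "p \<in> pts X"
  shows "cov_deriv_along X M g f N p v \<in> range (mderiv X M f p)"
proof -
  define c d where "c = chart_at X p" and "d = chart_at M (f p)"
  have fp: "f p \<in> pts M" by (rule in_pts[OF p])
  interpret G: inner_form "g (f p)" by (rule inner_form[OF fp])
  have c: "c \<in> atlas X" "p \<in> fst c" using chart_at[OF smooth_X p] by (auto simp: c_def)
  have d: "d \<in> atlas M" "f p \<in> fst d" using chart_at[OF smooth fp] by (auto simp: d_def)
  let ?S = "chart_image c" and ?x = "snd c p" and ?K = "snd d \<circ> f \<circ> chart_inv c"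
  have x: "?x \<in> ?S" using c(2) by (rule chart_in_image)
  have xp: "chart_inv c ?x = p" by (rule chart_inv_chart[OF smooth_X c])
  define Y where "Y = normal_rep c d"
  define Y' where "Y' = frechet_derivative Y (at ?x within ?S)"
  have Yx: "Y ?x = N p"
    unfolding Y_def using transition_self[OF smooth d] by (simp add: xp Let_def d_def)
  have "(Y has_derivative Y') (at ?x within ?S)"
    unfolding Y_def Y'_def by (rule normal_has_derivative[OF c d])
  note L = leibniz[OF fp x _ chart_has_derivative[OF c d] this this]
  have "((\<lambda>y. m d (?K y) (Y y) (Y y)) has_derivative
      (\<lambda>v. g (f p) (Y' v + levi_civita M g (f p) (chart_deriv c f d p v) (N p)) (N p) +
           g (f p) (N p) (Y' v + levi_civita M g (f p) (chart_deriv c f d p v) (N p))))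
      (at ?x within ?S)"
    using L by (simp add: xp Yx flip: d_def)
  moreover have "((\<lambda>y. m d (?K y) (Y y) (Y y)) has_derivative (\<lambda>v. 0)) (at ?x within ?S)"
  proof (rule has_derivative_transform_eventually[OF has_derivative_const[of 1]])
    have T: "openin (top_of_set ?S) (chart_domain c f d)" "?x \<in> chart_domain c f d"
      using domain_openin[OF c(1) d(1)] c d by auto
    have one: "1 = m d (?K y) (Y y) (Y y)" if y: "y \<in> chart_domain c f d" for y
    proof -
      let ?q = "chart_inv c y"
      note q = chart_domainD[OF smooth_X c(1) y]
      show ?thesis
        using metric_transition[OF d(1) q(3), of "N ?q" "N ?q"] normal_unit[OF q(2)]
        by (simp add: Y_def Let_def)
    qed
    show "1 = m d (?K ?x) (Y ?x) (Y ?x)" by (rule one[OF T(2)])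
    obtain V where "open V" "chart_domain c f d = ?S \<inter> V" using T(1) by (auto simp: openin_open)
    then show "\<forall>\<^sub>F y in at ?x within ?S. 1 = m d (?K y) (Y y) (Y y)"
      using T(2) one unfolding eventually_at_topological by (intro exI[of _ V]) auto
  qed (rule x)
  ultimately have "(\<lambda>v. g (f p) (Y' v + levi_civita M g (f p) (chart_deriv c f d p v) (N p)) (N p) +
           g (f p) (N p) (Y' v + levi_civita M g (f p) (chart_deriv c f d p v) (N p))) = (\<lambda>v. 0)"
    by (rule halfspace_open_derivative_unique[OF chart_halfspace_open[OF smooth_X c(1)] x])
  from fun_cong[OF this, of v]
  have "g (f p) (N p) (Y' v + levi_civita M g (f p) (chart_deriv c f d p v) (N p)) = 0"
    using G.sym[of "N p"] by simp
  moreover have "cov_deriv_along X M g f N p v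
      = Y' v + levi_civita M g (f p) (chart_deriv c f d p v) (N p)"
    by (simp add: cov_deriv_along_def Let_def mderiv_eq_chart_deriv Y'_def Y_def c_def d_def)
  ultimately show ?thesis using range_mderiv[OF p] by simp
qed

section \<open>The shape operator and the second fundamental form\<close>

lemma shape_operator_eqI:
  assumes p: "p \<in> pts X" and w: "mderiv X M f p w = - cov_deriv_along X M g f N p v"
  shows "shape_operator X M g f N p v = w"
  unfolding shape_operator_def
proof (rule the_equality)
  show "w' = w" if "mderiv X M f p w' = - cov_deriv_along X M g f N p v" for w'
    using injD[OF mderiv_inj[OF p]] that w by simp
qed (rule w)

lemma mderiv_shape_operator:
  assumes p: "p \<in> pts X"
  shows "mderiv X M f p (shape_operator X M g f N p v) = - cov_deriv_along X M g f N p v"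
proof -
  obtain w where "cov_deriv_along X M g f N p v = mderiv X M f p w"
    using cov_deriv_tangent[OF p] by blast
  then have w: "mderiv X M f p (- w) = - cov_deriv_along X M g f N p v"
    using linear_neg[OF mderiv_linear[OF p]] by simp
  then show ?thesis using shape_operator_eqI[OF p w] by simp
qed

lemma cov_deriv_linear:
  assumes p: "p \<in> pts X"
  shows "linear (cov_deriv_along X M g f N p)"
proof -
  define c d where "c = chart_at X p" and "d = chart_at M (f p)"
  have fp: "f p \<in> pts M" by (rule in_pts[OF p])
  have c: "c \<in> atlas X" "p \<in> fst c" using chart_at[OF smooth_X p] by (auto simp: c_def)
  have d: "d \<in> atlas M" "f p \<in> fst d" using chart_at[OF smooth fp] by (auto simp: d_def)
  have "linear (frechet_derivative (normal_rep c d) (at (snd c p) within chart_image c))"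
    using has_derivative_linear[OF normal_has_derivative[OF c d]] .
  moreover have "linear (\<lambda>v. levi_civita M g (f p) (mderiv X M f p v) (N p))"
    using levi_civita(1)[OF fp] mderiv_linear[OF p] linear_compose
    unfolding bilinear_def o_def by blast
  ultimately have "linear (\<lambda>v. frechet_derivative (normal_rep c d) (at (snd c p) within chart_image c) v
      + levi_civita M g (f p) (mderiv X M f p v) (N p))" by (rule linear_compose_add)
  then show ?thesis
    unfolding cov_deriv_along_def Let_def c_def d_def .
qed

lemma shape_operator_linear:
  assumes p: "p \<in> pts X"
  shows "linear (shape_operator X M g f N p)"
proof -
  note l = mderiv_linear[OF p] cov_deriv_linear[OF p] and s = mderiv_shape_operator[OF p]
  show ?thesis
  proof (rule linearI)
    show "shape_operator X M g f N p (u + v) = shape_operator X M g f N p u + shape_operator X M g f N p v"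
      for u v
      by (rule shape_operator_eqI[OF p]) (simp add: linear_add[OF l(1)] linear_add[OF l(2)] s)
    show "shape_operator X M g f N p (r *\<^sub>R v) = r *\<^sub>R shape_operator X M g f N p v" for r v
      by (rule shape_operator_eqI[OF p]) (simp add: linear_scale[OF l(1)] linear_scale[OF l(2)] s)
  qed
qed

text \<open>Differentiating \<open>\<langle>N, dh w\<rangle> = 0\<close>: the second fundamental form on vectors tangent to the
  submanifold \<open>Z\<close> is expressed by \<open>h\<close> and the value of the normal alone, so it does not
  distinguish hypersurfaces through \<open>Z\<close> with the same normal at the point.\<close>

lemma second_fundamental_form:
  fixes Z :: "('z, 's::euclidean_space) mfd"
  assumes Z: "smooth_manifold Z" and \<beta>: "smooth_map Z X \<beta>"
    and h: "\<And>z. z \<in> pts Z \<Longrightarrow> h z = f (\<beta> z)" and z: "z \<in> pts Z"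
    and c_def: "c = chart_at Z z" and d_def: "d = chart_at M (h z)"
    and D2: "\<And>w. ((\<lambda>y. frechet_derivative (snd d \<circ> h \<circ> chart_inv c) (at y within chart_image c) w)
        has_derivative (\<lambda>u. D2 u w)) (at (snd c z) within chart_image c)"
  shows "g (h z) (cov_deriv_along X M g f N (\<beta> z) (mderiv Z X \<beta> z u)) (mderiv Z M h z w)
       = - g (h z) (N (\<beta> z)) (D2 u w + levi_civita M g (h z) (mderiv Z M h z u) (mderiv Z M h z w))"
proof -
  have hsm: "smooth_map Z M h"
    by (rule smooth_map_compose[OF Z smooth_X smooth \<beta> smooth_map h])
  interpret h: smooth_maps_between Z M h by unfold_locales (rule Z smooth hsm)+
  interpret \<beta>: smooth_maps_between Z X \<beta> by unfold_locales (rule Z smooth_X \<beta>)+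
  have hz: "h z \<in> pts M" and bz: "\<beta> z \<in> pts X" using h.in_pts[OF z] \<beta>.in_pts[OF z] by auto
  have c: "c \<in> atlas Z" "z \<in> fst c" using chart_at[OF Z z] by (auto simp: c_def)
  have d: "d \<in> atlas M" "h z \<in> fst d" using chart_at[OF smooth hz] by (auto simp: d_def)
  define e where "e = chart_at X (\<beta> z)"
  have e: "e \<in> atlas X" "\<beta> z \<in> fst e" using chart_at[OF smooth_X bz] by (auto simp: e_def)
  have fd: "f (\<beta> z) \<in> fst d" using d(2) h[OF z] by simp
  let ?S = "chart_image c" and ?x = "snd c z" and ?K = "snd d \<circ> h \<circ> chart_inv c"
    and ?b = "snd e \<circ> \<beta> \<circ> chart_inv c"
  define Y where "Y y = (let q = chart_inv c y in
      transition (chart_at M (h q)) d (h q) (N (\<beta> q)))" for y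
  define Y' where "Y' = frechet_derivative (normal_rep e d) (at (snd e (\<beta> z)) within chart_image e)"
  have x: "?x \<in> ?S" using c(2) by (rule chart_in_image)
  have xz: "chart_inv c ?x = z" by (rule chart_inv_chart[OF Z c])
  have Yx: "Y ?x = N (\<beta> z)"
    unfolding Y_def using transition_self[OF smooth d] by (simp add: xz Let_def d_def)
  \<comment> \<open>\<open>Y\<close> is \<open>normal_rep e d\<close> pulled back by
    \<open>\<beta>\<close>, so the chain rule inserts the differential of \<open>\<beta>\<close>.
    This is how the covariant derivative of \<open>N\<close> in a direction tangent to
    \<open>X\<close> enters.\<close>
  have Y: "(Y has_derivative (\<lambda>v. Y' (chart_deriv c \<beta> e z v))) (at ?x within ?S)"
  proof -
    let ?T = "chart_domain c \<beta> e"
    have T: "openin (top_of_set ?S) ?T" "?x \<in> ?T" using \<beta>.domain_openin c e by auto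
    have bx: "?b ?x = snd e (\<beta> z)" by (simp add: xz)
    have sub: "?b ` ?T \<subseteq> chart_image e"
    proof (rule image_subsetI)
      fix y assume "y \<in> ?T"
      from chart_in_image[OF chart_domainD(3)[OF Z c(1) this]] show "?b y \<in> chart_image e" by simp
    qed
    have G: "(normal_rep e d has_derivative Y') (at (?b ?x) within ?b ` ?T)"
      unfolding bx Y'_def by (rule has_derivative_subset[OF normal_has_derivative[OF e d(1) fd] sub])
    have F: "(?b has_derivative chart_deriv c \<beta> e z) (at ?x within ?T)"
      using \<beta>.chart_has_derivative[OF c e] at_within_openin[OF T] by simp
    have "(Y has_derivative (\<lambda>v. Y' (chart_deriv c \<beta> e z v))) (at ?x within ?T)"
    proof (rule has_derivative_transform[OF T(2) _ has_derivative_in_compose[OF F G]])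
      fix y assume y: "y \<in> ?T"
      note q = chart_domainD[OF Z c(1) y]
      show "Y y = normal_rep e d (?b y)"
        using chart_inv_chart[OF smooth_X e(1) q(3)] h[OF q(2)] by (simp add: Y_def Let_def)
    qed
    then show ?thesis using at_within_openin[OF T] by simp
  qed
  \<comment> \<open>The extension of the tangent vector: the constant coordinate field
    \<open>w\<close> of the chart \<open>c\<close>, pushed forward by \<open>h\<close>, with
    derivative \<open>D2\<close> at the base point.\<close>
  define W where "W y = frechet_derivative ?K (at y within ?S) w" for y
  have W: "(W has_derivative (\<lambda>u. D2 u w)) (at ?x within ?S)" unfolding W_def by (rule D2)
  have K': "chart_deriv c h d z = mderiv Z M h z"
    by (simp add: mderiv_eq_chart_deriv c_def d_def)
  have Wx: "W ?x = mderiv Z M h z w" by (simp add: W_def flip: K')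
  have b': "chart_deriv c \<beta> e z = mderiv Z X \<beta> z"
    by (simp add: mderiv_eq_chart_deriv c_def e_def)
  note L = leibniz[OF hz x _ h.chart_has_derivative[OF c d] Y W]
  let ?\<Gamma> = "levi_civita M g (h z)" and ?D = "mderiv Z M h z"
  have "((\<lambda>y. m d (?K y) (Y y) (W y)) has_derivative
      (\<lambda>v. g (h z) (Y' (mderiv Z X \<beta> z v) + ?\<Gamma> (?D v) (N (\<beta> z))) (?D w) +
           g (h z) (N (\<beta> z)) (D2 v w + ?\<Gamma> (?D v) (?D w)))) (at ?x within ?S)"
    using L by (simp add: xz Yx Wx K' b' flip: d_def)
  moreover have "((\<lambda>y. m d (?K y) (Y y) (W y)) has_derivative (\<lambda>v. 0)) (at ?x within ?S)"
  proof (rule has_derivative_transform_eventually[OF has_derivative_const[of 0]])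
    have T: "openin (top_of_set ?S) (chart_domain c h d)" "?x \<in> chart_domain c h d"
      using h.domain_openin[OF c(1) d(1)] c d by auto
    have zero: "0 = m d (?K y) (Y y) (W y)" if y: "y \<in> chart_domain c h d" for y
    proof -
      define q where "q = chart_inv c y"
      have q: "q \<in> fst c" "q \<in> pts Z" "h q \<in> fst d" "snd c q = y"
        using chart_domainD[OF Z c(1) y] by (auto simp: q_def)
      have hq: "h q \<in> pts M" and bq: "\<beta> q \<in> pts X" using h.in_pts[OF q(2)] \<beta>.in_pts[OF q(2)] by auto
      \<comment> \<open>Away from \<open>z\<close> the chart \<open>c\<close> need not be the
        preferred one, so \<open>mderiv\<close> is replaced by a derivative in \<open>c\<close>.
        Then \<open>W y\<close> is the image of \<open>a\<close> under the differential of
        \<open>f\<close>, which is orthogonal to the normal.\<close>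
      define a where "a = chart_deriv c \<beta> (chart_at X (\<beta> q)) q w"
      have "W y = chart_deriv c h d q w" by (simp add: W_def q(4))
      also have "\<dots> = transition (chart_at M (h q)) d (h q) (chart_deriv c h (chart_at M (h q)) q w)"
        by (rule transition_chart_deriv[OF Z smooth hsm c(1) q(1) chart_at[OF smooth hq] d(1) q(3),
              symmetric])
      also have "chart_deriv c h (chart_at M (h q)) q w = mderiv X M f (\<beta> q) a"
        unfolding a_def mderiv_eq_chart_deriv h[OF q(2), symmetric]
        by (rule chart_deriv_compose[OF Z smooth_X smooth \<beta> smooth_map h c(1) q(1)
              chart_at[OF smooth_X bq] chart_at[OF smooth hq]])
      finally have Wy: "W y = transition (chart_at M (h q)) d (h q) (mderiv X M f (\<beta> q) a)" .
      have "m d (snd d (h q)) (Y y) (W y) = g (h q) (N (\<beta> q)) (mderiv X M f (\<beta> q) a)"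
        unfolding Wy Y_def Let_def q_def[symmetric] by (rule metric_transition[OF d(1) q(3)])
      also have "\<dots> = 0" using normal_orthogonal[OF bq] h[OF q(2)] by simp
      finally show ?thesis by (simp add: q_def)
    qed
    show "0 = m d (?K ?x) (Y ?x) (W ?x)" by (rule zero[OF T(2)])
    obtain V where "open V" "chart_domain c h d = ?S \<inter> V" using T(1) by (auto simp: openin_open)
    then show "\<forall>\<^sub>F y in at ?x within ?S. 0 = m d (?K y) (Y y) (W y)"
      using T(2) zero unfolding eventually_at_topological by (intro exI[of _ V]) auto
  qed (rule x)
  ultimately have "(\<lambda>v. g (h z) (Y' (mderiv Z X \<beta> z v) + ?\<Gamma> (?D v) (N (\<beta> z))) (?D w) +
           g (h z) (N (\<beta> z)) (D2 v w + ?\<Gamma> (?D v) (?D w))) = (\<lambda>v. 0)"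
    by (rule halfspace_open_derivative_unique[OF chart_halfspace_open[OF Z c(1)] x])
  from fun_cong[OF this, of u]
  have "g (h z) (Y' (mderiv Z X \<beta> z u) + ?\<Gamma> (?D u) (N (\<beta> z))) (?D w)
      = - g (h z) (N (\<beta> z)) (D2 u w + ?\<Gamma> (?D u) (?D w))" by simp
  moreover have "?D u = mderiv X M f (\<beta> z) (mderiv Z X \<beta> z u)"
    by (rule mderiv_compose[OF Z smooth_X smooth \<beta> smooth_map h z])
  then have "cov_deriv_along X M g f N (\<beta> z) (mderiv Z X \<beta> z u)
      = Y' (mderiv Z X \<beta> z u) + ?\<Gamma> (?D u) (N (\<beta> z))"
    by (simp add: cov_deriv_along_def Let_def Y'_def e_def d_def h[OF z])
  ultimately show ?thesis by simp
qed

text \<open>This is \<open>second_fundamental_form\<close> for the submanifold \<open>X\<close>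
  itself with \<open>\<beta> = id\<close>: the right-hand side is symmetric because the Hessian and
  the torsion-free connection are.\<close>

lemma shape_operator_selfadjoint:
  assumes p: "p \<in> pts X"
  shows "g (f p) (mderiv X M f p (shape_operator X M g f N p u)) (mderiv X M f p v)
       = g (f p) (mderiv X M f p u) (mderiv X M f p (shape_operator X M g f N p v))"
proof -
  define c d where "c = chart_at X p" and "d = chart_at M (f p)"
  have fp: "f p \<in> pts M" by (rule in_pts[OF p])
  interpret G: inner_form "g (f p)" by (rule inner_form[OF fp])
  have c: "c \<in> atlas X" "p \<in> fst c" using chart_at[OF smooth_X p] by (auto simp: c_def)
  have d: "d \<in> atlas M" "f p \<in> fst d" using chart_at[OF smooth fp] by (auto simp: d_def)
  obtain D2 where D2: "\<And>v. ((\<lambda>y. frechet_derivative (snd d \<circ> f \<circ> chart_inv c) (at y within chart_image c) v)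
        has_derivative (\<lambda>u. D2 u v)) (at (snd c p) within chart_image c)"
    and symD2: "\<And>u v. D2 u v = D2 v u"
    using chart_second_derivative[OF c d] by blast
  have *: "g (f p) (mderiv X M f p (shape_operator X M g f N p u)) (mderiv X M f p v)
      = g (f p) (N p) (D2 u v + levi_civita M g (f p) (mderiv X M f p u) (mderiv X M f p v))" for u v
    using second_fundamental_form[OF smooth_X smooth_map_id[OF smooth_X] _ p c_def d_def D2, of u v]
    by (simp add: mderiv_shape_operator[OF p] mderiv_id[OF smooth_X p] G.G_simps)
  show ?thesis
    unfolding * G.sym[of "mderiv X M f p u"]
    using symD2[of u v] levi_civita(2)[OF fp, of "mderiv X M f p u" "mderiv X M f p v"] by simp
qed

end

subsection \<open>Tangency at a boundary point\<close>

lemma tangent_boundary_point: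
  fixes Mbar :: "('a, 'e::euclidean_space) mfd" and P :: "('a, 'x::euclidean_space) mfd"
    and \<Sigma> :: "('a, 's::euclidean_space) mfd" and M :: "('m, 'x) mfd"
  assumes M: "immersed_hypersurface Mbar gbar M \<psi> N" "riemannian_metric M g"
    "isometric_immersion M g Mbar gbar \<psi>"
    and P: "immersed_hypersurface Mbar gbar P id \<xi>" "totally_geodesic P Mbar gbar id \<xi>"
    and \<Sigma>: "embedded_submanifold \<Sigma> P" "DIM('x) = DIM('s) + 1" "has_boundary M \<psi> \<Sigma>"
    and p: "p \<in> mboundary M"
    and tangent: "range (mderiv M Mbar \<psi> p) = range (mderiv P Mbar id (\<psi> p))"
  defines "A \<equiv> shape_operator M Mbar gbar \<psi> N p"
  shows "sym_fun 2 A \<le> 0" and "\<And>r. r \<ge> 3 \<Longrightarrow> sym_fun r A = 0"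
    and "\<exists>\<nu>. \<nu> \<noteq> 0 \<and> (\<forall>r\<ge>1. g p (newton r A \<nu>) \<nu> = 0)"
proof -
  interpret M: immersed_hypersurface Mbar gbar M \<psi> N by (rule M)
  interpret P: immersed_hypersurface Mbar gbar P id \<xi> by (rule P)
  have S: "smooth_manifold \<Sigma>" "pts \<Sigma> \<subseteq> pts P" "immersion \<Sigma> P id"
    using \<Sigma>(1) by (auto simp: embedded_submanifold_def)
  have \<iota>: "smooth_map \<Sigma> P id" using S(3) by (simp add: immersion_def)
  \<comment> \<open>With this inverse the inclusion of \<Sigma> equals \<open>\<psi>\<close> after
    \<open>\<beta>\<close> on \<Sigma>, besides being the inclusion through \<open>P\<close>; both
    factorizations share the map \<open>id\<close>.\<close>
  define \<beta> where "\<beta> = inv_into (mboundary M) \<psi>"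
  define z where "z = \<psi> p"
  have bij: "bij_betw \<psi> (mboundary M) (pts \<Sigma>)" and \<beta>: "smooth_map \<Sigma> M \<beta>"
    using \<Sigma>(3) by (auto simp: has_boundary_def \<beta>_def)
  have z: "z \<in> pts \<Sigma>" using bij_betwE[OF bij] p by (simp add: z_def)
  have \<beta>z: "\<beta> z = p" using bij_betw_inv_into_left[OF bij p] by (simp add: \<beta>_def z_def)
  have \<psi>\<beta>: "id w = \<psi> (\<beta> w)" if "w \<in> pts \<Sigma>" for w
    using bij_betw_inv_into_right[OF bij that] by (simp add: \<beta>_def)
  have pM: "p \<in> pts M" using p by (simp add: mboundary_def)
  have zP: "z \<in> pts P" using z S(2) by blast
  have h: "smooth_map \<Sigma> Mbar id"
    by (rule smooth_map_compose[OF S(1) P.smooth_X M.smooth \<iota> P.smooth_map]) simp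
  interpret h: smooth_maps_between \<Sigma> Mbar id by unfold_locales (rule S(1) M.smooth h)+
  interpret \<beta>: smooth_maps_between \<Sigma> M \<beta> by unfold_locales (rule S(1) M.smooth_X \<beta>)+
  have zMbar: "id z \<in> pts Mbar" by (rule h.in_pts[OF z])
  define c d where "c = chart_at \<Sigma> z" and "d = chart_at Mbar (id z)"
  have c: "c \<in> atlas \<Sigma>" "z \<in> fst c" using chart_at[OF S(1) z] by (auto simp: c_def)
  have d: "d \<in> atlas Mbar" "id z \<in> fst d" using chart_at[OF M.smooth zMbar] by (auto simp: d_def)
  obtain D2 where D2: "\<And>v. ((\<lambda>y. frechet_derivative (snd d \<circ> id \<circ> chart_inv c) (at y within chart_image c) v)
        has_derivative (\<lambda>u. D2 u v)) (at (snd c z) within chart_image c)"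
    using h.chart_second_derivative[OF c d] by blast
  let ?D\<beta> = "mderiv \<Sigma> M \<beta> z" and ?D\<iota> = "mderiv \<Sigma> P id z" and ?D = "mderiv \<Sigma> Mbar id z"
  have D\<beta>: "?D w = mderiv M Mbar \<psi> p (?D\<beta> w)" for w
    using mderiv_compose[where h = id, OF S(1) M.smooth_X M.smooth \<beta> M.smooth_map \<psi>\<beta> z] by (simp add: \<beta>z)
  have D\<iota>: "?D w = mderiv P Mbar id z (?D\<iota> w)" for w
    using mderiv_compose[where h = id, OF S(1) P.smooth_X M.smooth \<iota> P.smooth_map _ z] by simp
  interpret B: inner_form "gbar z" using M.inner_form zMbar by simp
  \<comment> \<open>Total geodesy makes \<open>?II\<close> orthogonal to \<open>\<xi>\<close>, that
    is, tangent to \<open>P\<close>. By tangency it is tangent to \<open>M\<close>, hence orthogonal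
    to \<open>N\<close>. Working with tangent spaces avoids fixing the sign relating
    \<open>\<xi>\<close> and \<open>N\<close>.\<close>
  have flat: "gbar z (cov_deriv_along M Mbar gbar \<psi> N p (?D\<beta> u)) (?D w) = 0" for u w
  proof -
    let ?II = "D2 u w + levi_civita Mbar gbar z (?D u) (?D w)"
    have "mderiv P Mbar id z (shape_operator P Mbar gbar id \<xi> z (?D\<iota> u))
        = - cov_deriv_along P Mbar gbar id \<xi> z (?D\<iota> u)"
      by (rule P.mderiv_shape_operator[OF zP])
    moreover have "shape_operator P Mbar gbar id \<xi> z (?D\<iota> u) = 0"
      using P(2) zP by (simp add: totally_geodesic_def)
    ultimately have "cov_deriv_along P Mbar gbar id \<xi> z (?D\<iota> u) = 0"
      using linear_0[OF P.mderiv_linear[OF zP]] by simp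
    then have "gbar z (\<xi> z) ?II = 0"
      using P.second_fundamental_form[OF S(1) \<iota> _ z c_def d_def D2, of u w]
      by (simp add: B.G_simps)
    then have "?II \<in> range (mderiv P Mbar id z)" using P.range_mderiv[OF zP] by simp
    then have "?II \<in> range (mderiv M Mbar \<psi> p)" using tangent by (simp add: z_def)
    then have "gbar z (N p) ?II = 0" using M.range_mderiv[OF pM] by (simp add: z_def)
    then show ?thesis
      using M.second_fundamental_form[OF S(1) \<beta> \<psi>\<beta> z c_def d_def D2, of u w] by (simp add: \<beta>z)
  qed
  interpret G: inner_form "g p"
    using M(2) pM unfolding riemannian_metric_def inner_form_def by simp
  have iso: "g p u v = gbar z (mderiv M Mbar \<psi> p u) (mderiv M Mbar \<psi> p v)" for u v
    using M(3) pM by (simp add: isometric_immersion_def z_def)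
  have vanish: "g p (A (?D\<beta> u)) (?D\<beta> w) = 0" for u w
    using flat[of u w] M.mderiv_shape_operator[OF pM, of "?D\<beta> u"]
    by (simp add: iso A_def D\<beta> B.G_simps)
  have self: "g p (A u) v = g p u (A v)" for u v
    using M.shape_operator_selfadjoint[OF pM, of u v] by (simp add: iso A_def z_def)
  have lin: "linear A" unfolding A_def by (rule M.shape_operator_linear[OF pM])
  \<comment> \<open>Followed by the differential of \<open>\<psi>\<close>, this map is the
    differential of the inclusion of \<Sigma> through \<open>P\<close>, a composite of two injective
    maps. Its range is therefore a hyperplane.\<close>
  have "inj ?D\<beta>"
  proof (rule injI)
    fix u v assume "?D\<beta> u = ?D\<beta> v"
    then have "mderiv P Mbar id z (?D\<iota> u) = mderiv P Mbar id z (?D\<iota> v)"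
      using D\<beta>[of u] D\<beta>[of v] D\<iota>[of u] D\<iota>[of v] by simp
    then have "?D\<iota> u = ?D\<iota> v" by (rule injD[OF P.mderiv_inj[OF zP]])
    moreover have "inj ?D\<iota>" using S(3) z by (simp add: immersion_def)
    ultimately show "u = v" by (simp add: injD)
  qed
  then have "dim (range ?D\<beta>) = DIM('x) - 1"
    using dim_image_eq[OF \<beta>.mderiv_linear[OF z], of UNIV] \<Sigma>(2) by simp
  \<comment> \<open>A unit conormal of the boundary at \<open>p\<close>, determined up to sign; it
    is the vector on which positivity of the Newton transformations fails.\<close>
  then obtain \<nu> where \<nu>: "g p \<nu> \<nu> = 1" "range ?D\<beta> = {x. g p \<nu> x = 0}"
    using G.hyperplane_unit_normal[OF linear_subspace_image[OF \<beta>.mderiv_linear[OF z] subspace_UNIV]]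
    by blast
  have "g p (A e) f = 0" if ef: "g p \<nu> e = 0" "g p \<nu> f = 0" for e f
  proof -
    have "e \<in> range ?D\<beta>" "f \<in> range ?D\<beta>" using ef \<nu>(2) by auto
    then show ?thesis using vanish by blast
  qed
  note * = G.selfadjoint_vanishing_on_hyperplane[OF lin self \<nu>(1) this]
  show "sym_fun 2 A \<le> 0" by (rule *(1))
  show "sym_fun r A = 0" if "r \<ge> 3" for r by (rule *(2)[OF _ _ that])
  have "\<nu> \<noteq> 0" using \<nu>(1) by (auto simp: G.G_simps)
  moreover have "g p (newton r A \<nu>) \<nu> = 0" if "r \<ge> 1" for r by (rule *(3)[OF _ _ that])
  ultimately show "\<exists>\<nu>. \<nu> \<noteq> 0 \<and> (\<forall>r\<ge>1. g p (newton r A \<nu>) \<nu> = 0)" by blast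
qed

theorem proposition6p2:
  fixes Mbar :: "('a, real^'k) mfd" and gbar :: "('a, real^'k) metric"
    and OrBar :: "('a, real^'k) chart set"
    and P :: "('a, real^'n) mfd" and gP :: "('a, real^'n) metric" and \<xi> :: "'a \<Rightarrow> real^'k"
    and \<Sigma> :: "('a, real^'s) mfd"
    and M :: "('m, real^'n) mfd" and g :: "('m, real^'n) metric"
    and \<psi> :: "'m \<Rightarrow> 'a" and N :: "'m \<Rightarrow> real^'k"
  defines "A \<equiv> shape_operator M Mbar gbar \<psi> N"
  assumes "smooth_manifold Mbar" and "mboundary Mbar = {}" and "connected_space (mtop Mbar)"
    and "orientation Mbar OrBar" and "riemannian_metric Mbar gbar"
    and "pts P \<subseteq> pts Mbar" and "hypersurface P gP Mbar gbar id \<xi>"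
    and "totally_geodesic P Mbar gbar id \<xi>"
    and "CARD('n) = CARD('s) + 1" and "embedded_submanifold \<Sigma> P"
    and "compact_space (mtop \<Sigma>)" and "orientable \<Sigma>"
    and "hypersurface M g Mbar gbar \<psi> N" and "has_boundary M \<psi> \<Sigma>"
  shows "((\<exists>r\<in>{1..CARD('n) - 1}. \<forall>p\<in>pts M. \<forall>v. v \<noteq> 0 \<longrightarrow> g p (newton r (A p) v) v > 0)
            \<longrightarrow> transverse_along_boundary M Mbar \<psi> P) \<and>
         (CARD('n) \<ge> 3 \<and> (\<forall>p\<in>pts M. sym_fun CARD('n) (A p) \<noteq> 0)
            \<longrightarrow> transverse_along_boundary M Mbar \<psi> P) \<and>
         ((\<forall>p\<in>pts M. sym_fun 2 (A p) > 0)
            \<longrightarrow> transverse_along_boundary M Mbar \<psi> P)"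
proof -
  \<comment> \<open>The point type \<open>'b\<close> is generic so that the facts apply both to
    \<open>P\<close> and to \<open>M\<close>.\<close>
  have hyp: "immersed_hypersurface Mbar gbar X f \<nu>" "isometric_immersion X gX Mbar gbar f"
    "riemannian_metric X gX"
    if "hypersurface X gX Mbar gbar f \<nu>"
    for X :: "('b, real^'n) mfd" and gX :: "('b, real^'n) metric" and f \<nu>
    using that assms(2,3,6)
    by (auto simp: hypersurface_def isometric_immersion_def immersed_hypersurface_def
        immersed_hypersurface_axioms_def riemannian_def)
  have dim: "DIM(real^'n) = DIM(real^'s) + 1" using assms(10) by simp
  {
    fix p assume p: "p \<in> mboundary M"
      and tangent: "range (mderiv M Mbar \<psi> p) = range (mderiv P Mbar id (\<psi> p))"
    have "p \<in> pts M" using p by (simp add: mboundary_def)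
    note * = this tangent_boundary_point[OF hyp(1)[OF assms(14)] hyp(3)[OF assms(14)]
        hyp(2)[OF assms(14)] hyp(1)[OF assms(8)] assms(9,11) dim assms(15) p tangent]
  } note * = this
  show ?thesis
    unfolding transverse_along_boundary_def
  proof (intro conjI impI ballI notI)
    fix p assume r: "\<exists>r\<in>{1..CARD('n) - 1}. \<forall>p\<in>pts M. \<forall>v. v \<noteq> 0 \<longrightarrow> g p (newton r (A p) v) v > 0"
      and p: "p \<in> mboundary M" "range (mderiv M Mbar \<psi> p) = range (mderiv P Mbar id (\<psi> p))"
    obtain \<nu> where "\<nu> \<noteq> 0" "\<And>r. r \<ge> 1 \<Longrightarrow> g p (newton r (A p) \<nu>) \<nu> = 0"
      using *(4)[OF p] unfolding A_def by blast
    then show False using r *(1)[OF p] by force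
  next
    fix p assume S: "3 \<le> CARD('n) \<and> (\<forall>p\<in>pts M. sym_fun CARD('n) (A p) \<noteq> 0)"
      and p: "p \<in> mboundary M" "range (mderiv M Mbar \<psi> p) = range (mderiv P Mbar id (\<psi> p))"
    \<comment> \<open>The index is n itself, and n at least 3 places it in the range where the
      symmetric functions vanish.\<close>
    then show False using *(1,3)[OF p] unfolding A_def by blast
  next
    fix p assume S: "\<forall>p\<in>pts M. sym_fun 2 (A p) > 0"
      and p: "p \<in> mboundary M" "range (mderiv M Mbar \<psi> p) = range (mderiv P Mbar id (\<psi> p))"
    then show False using *(1,2)[OF p] unfolding A_def by (meson not_less)
  qed
qed

end
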